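(* Let $(\phi,\eta,\xi,G)$ be a para-Sasakian Finsler structure on a vector bundle $E$, and let $D$ be a Finsler connection on $E$ with curvature $R$. Suppose that $E$ is locally symmetric. Then $E$ has vertical $\phi$-flag curvature $-\frac14$, i.e. every vertical $\phi$-section has vertical flag curvature $-\frac14$.
   Context: Setting. $(E,\pi,M)$ is a smooth vector bundle with $\dim M=n$ and fibre dimension $m$; $E$ also denotes the $(n+m)$-dimensional total space. $VE$ is the vertical bundle, and a nonlinear connection is fixed, i.e. a smooth distribution $HE$ on $E$ with $TE=HE\oplus VE$. For a vector field $X$ on $E$, $X^H$ and $X^V$ denote its horizontal and vertical components, so $X=X^H+X^V$. For a 1-form $\omega$ on $E$, $\omega^H(X)=\omega(X^H)$ and $\omega^V(X)=\omega(X^V)$. Almost paracontact Finsler structure. It is a triple $(\phi,\eta,\xi)$ where $\phi$ is a $(1,1)$-tensor field on $E$ with $\phi(HE)\subseteq HE$ and $\phi(VE)\subseteq VE$, $\eta$ is a 1-form on $E$ and $\xi$ is a vector field on $E$, such that $$\phi^2=I-\eta^H\otimes\xi^H-\eta^V\otimes\xi^V,\qquad \eta^H(\xi^H)=\eta^V(\xi^V)=1 .$$ With $d\omega(X,Y)=X(\omega(Y))-Y(\omega(X))-\omega([X,Y])$ for a 1-form $\omega$ and $N_\phi(X,Y)=\phi^2[X,Y]+[\phi X,\phi Y]-\phi[\phi X,Y]-\phi[X,\phi Y]$, the structure is normal if $N^{(1)}(X,Y)=N_\phi(X,Y)-d\eta^H(X,Y)\xi^H-d\eta^V(X,Y)\xi^V=0$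 for all vector fields $X,Y$ on $E$. Metric structures. A pseudo-metric structure on $E$ is a symmetric non-degenerate $(0,2)$-tensor $G=G^H+G^V$ with $G^H(X,Y)=G(X^H,Y^H)$ non-degenerate on $HE$ and $G^V(X,Y)=G(X^V,Y^V)$ non-degenerate on $VE$. $(\phi,\eta,\xi,G)$ is an almost paracontact metric Finsler structure if $(\phi,\eta,\xi)$ is an almost paracontact Finsler structure and $$G^H(\phi X,\phi Y)=-G^H(X,Y)+\eta^H(X)\eta^H(Y),\quad G^V(\phi X,\phi Y)=-G^V(X,Y)+\eta^V(X)\eta^V(Y).$$ Its fundamental 2-form is $\Phi(X,Y)=G(X,\phi Y)$. It is a paracontact metric Finsler structure if $d\eta^H(X,Y)=\Phi(X^H,Y^H)$ and $d\eta^V(X,Y)=\Phi(X^V,Y^V)$ for all vector fields $X,Y$ on $E$. A para-Sasakian Finsler structure is a normal paracontact metric Finsler structure. Finsler connection. A linear connection $D$ on $E$ is a d-connection if it preserves $HE$ and $VE$ by parallelism ($Dh=0=Dv$ for the projectors $h,v$ onto $HE,VE$). It is metrical if $D_XG=0$ for all $X$. It is symmetric if $D_{X^H}Y^H-D_{Y^H}X^H-[X^H,Y^H]^H=0$ and $D_{X^V}Y^V-D_{Y^V}X^V-[X^V,Y^V]^V=0$ for all $X,Y$. A Finsler connection is a symmetric metrical d-connection. Curvature: $R(X,Y)Z=D_XD_YZ-D_YD_XZ-D_{[X,Y]}Z$. $E$ is locally symmetric if $DR=0$. Vertical $\phi$-flag curvature. A plane section in $V_uE$ is a vertical $\phi$-section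 if there is a unit vector $X^V\in V_uE$ orthogonal to $\xi^V$ such that $\{X^V,\phi X^V\}$ spans the section. Its vertical flag curvature $$K(X^V,\phi X^V)=\frac{G(R(X^V,\phi X^V)\phi X^V,X^V)}{G(X^V,X^V)\,G(\phi X^V,\phi X^V)}$$ is called the vertical $\phi$-flag curvature. *)

theory Defs
  imports "HOL-Analysis.Analysis" "HOL-Library.Function_Algebras"
begin

text \<open>
  Sums, differences and products of functions are pointwise (Function_Algebras).  Manifolds are
  whole types of class second_countable_topology and t2_space, together with an explicit smooth
  atlas.  Vector fields are derivations of the algebra of smooth functions, tangent vectors are
  point derivations, and tensor fields are multilinear maps over that algebra.
\<close>

section \<open>Smooth manifolds\<close>

text \<open>Both notions are meant for open sets \<open>S\<close>.\<close>

primrec Ck_on :: "nat \<Rightarrow> 'a::euclidean_space set \<Rightarrow> ('a \<Rightarrow> 'b::real_normed_vector) \<Rightarrow> bool" where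
  "Ck_on 0 S f = continuous_on S f"
| "Ck_on (Suc k) S f =
     ((\<forall>x\<in>S. f differentiable (at x)) \<and>
      (\<forall>v. Ck_on k S (\<lambda>x. frechet_derivative f (at x) v)))"

definition smooth_on :: "'a::euclidean_space set \<Rightarrow> ('a \<Rightarrow> 'b::real_normed_vector) \<Rightarrow> bool" where
  "smooth_on S f \<longleftrightarrow> (\<forall>k. Ck_on k S f)"

type_synonym ('p, 'a) chart = "'p set \<times> ('p \<Rightarrow> 'a)"

definition is_chart :: "('p::topological_space, 'a::euclidean_space) chart \<Rightarrow> bool" where
  "is_chart = (\<lambda>(U, c). open U \<and> open (c ` U) \<and> homeomorphism U (c ` U) c (inv_into U c))"

definition compatible ::
  "('p, 'a::euclidean_space) chart \<Rightarrow> ('p, 'a) chart \<Rightarrow> bool" where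
  "compatible = (\<lambda>(U, c) (W, d).
     smooth_on (c ` (U \<inter> W)) (d \<circ> inv_into U c) \<and>
     smooth_on (d ` (U \<inter> W)) (c \<circ> inv_into W d))"

definition smooth_atlas ::
  "('p::{second_countable_topology, t2_space}, 'a::euclidean_space) chart set \<Rightarrow> bool" where
  "smooth_atlas A \<longleftrightarrow>
     (\<Union>K\<in>A. fst K) = UNIV \<and> (\<forall>K\<in>A. is_chart K) \<and> (\<forall>K\<in>A. \<forall>L\<in>A. compatible K L)"

definition smooth_map ::
  "('p::topological_space, 'a::euclidean_space) chart set \<Rightarrow>
   ('q::topological_space, 'b::euclidean_space) chart set \<Rightarrow> ('p \<Rightarrow> 'q) \<Rightarrow> bool" where
  "smooth_map A B F \<longleftrightarrow> continuous_on UNIV F \<and>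
     (\<forall>(U, c)\<in>A. \<forall>(W, d)\<in>B. smooth_on (c ` (U \<inter> F -` W)) (d \<circ> F \<circ> inv_into U c))"

definition smooth_fun :: "('p, 'a::euclidean_space) chart set \<Rightarrow> ('p \<Rightarrow> real) set" where
  "smooth_fun A = {f. \<forall>(U, c)\<in>A. smooth_on (c ` U) (f \<circ> inv_into U c)}"


section \<open>Vector bundles\<close>

text \<open>
  A local trivialization over \<open>U\<close> is \<open>e \<mapsto> (\<pi> e, \<psi> e)\<close>.  That it is a diffeomorphism onto
  \<open>U \<times> \<real>\<^sup>m\<close> is expressed by requiring that its compositions with the charts of the base are
  charts of the smooth structure of the total space.
\<close>

definition local_trivialization ::
  "('b::topological_space, real^'n) chart set \<Rightarrow>
   ('e::topological_space, (real^'n) \<times> (real^'m)) chart set \<Rightarrow>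
   ('e \<Rightarrow> 'b) \<Rightarrow> ('e \<Rightarrow> 'e \<Rightarrow> 'e) \<Rightarrow> (real \<Rightarrow> 'e \<Rightarrow> 'e) \<Rightarrow>
   'b set \<Rightarrow> ('e \<Rightarrow> real^'m) \<Rightarrow> bool" where
  "local_trivialization AB AT \<pi> vadd vscale U \<psi> \<longleftrightarrow>
     open U \<and>
     bij_betw (\<lambda>e. (\<pi> e, \<psi> e)) (\<pi> -` U) (U \<times> UNIV) \<and>
     (\<forall>(W, c)\<in>AB.
        is_chart (\<pi> -` (U \<inter> W), \<lambda>e. (c (\<pi> e), \<psi> e)) \<and>
        (\<forall>K\<in>AT. compatible (\<pi> -` (U \<inter> W), \<lambda>e. (c (\<pi> e), \<psi> e)) K)) \<and>
     (\<forall>e e'. \<pi> e \<in> U \<and> \<pi> e' = \<pi> e \<longrightarrow> \<psi> (vadd e e') = \<psi> e + \<psi> e') \<and>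
     (\<forall>r e. \<pi> e \<in> U \<longrightarrow> \<psi> (vscale r e) = r *\<^sub>R \<psi> e)"

text \<open>
  \<open>vadd\<close> and \<open>vscale\<close> are the fibrewise operations; \<open>vadd\<close> is only relevant on two points of one
  fibre.  The vector space axioms on a fibre follow, since a trivialization restricts there to a
  bijection onto \<open>\<real>\<^sup>m\<close> that respects the operations.
\<close>

definition smooth_vector_bundle ::
  "('b::{second_countable_topology, t2_space}, real^'n) chart set \<Rightarrow>
   ('e::{second_countable_topology, t2_space}, (real^'n) \<times> (real^'m)) chart set \<Rightarrow>
   ('e \<Rightarrow> 'b) \<Rightarrow> ('e \<Rightarrow> 'e \<Rightarrow> 'e) \<Rightarrow> (real \<Rightarrow> 'e \<Rightarrow> 'e) \<Rightarrow> bool" where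
  "smooth_vector_bundle AB AT \<pi> vadd vscale \<longleftrightarrow>
     smooth_atlas AB \<and> smooth_atlas AT \<and> smooth_map AT AB \<pi> \<and> surj \<pi> \<and>
     (\<forall>e e'. \<pi> e' = \<pi> e \<longrightarrow> \<pi> (vadd e e') = \<pi> e) \<and>
     (\<forall>r e. \<pi> (vscale r e) = \<pi> e) \<and>
     (\<forall>p. \<exists>U \<psi>. p \<in> U \<and> local_trivialization AB AT \<pi> vadd vscale U \<psi>)"


section \<open>Tangent vectors and vector fields\<close>

type_synonym 'p tvec = "('p \<Rightarrow> real) \<Rightarrow> real"
type_synonym 'p vfield = "('p \<Rightarrow> real) \<Rightarrow> ('p \<Rightarrow> real)"
type_synonym 'p dist = "'p \<Rightarrow> 'p tvec set"

text \<open>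
  Derivations are set to 0 on functions that are not smooth, so that equality of tangent vectors
  and of vector fields is equality of functions.
\<close>

definition tangent_space :: "('p, 'a::euclidean_space) chart set \<Rightarrow> 'p dist" where
  "tangent_space A u = {x.
     (\<forall>f\<in>smooth_fun A. \<forall>g\<in>smooth_fun A. x (f + g) = x f + x g) \<and>
     (\<forall>f\<in>smooth_fun A. \<forall>r. x (\<lambda>p. r * f p) = r * x f) \<and>
     (\<forall>f\<in>smooth_fun A. \<forall>g\<in>smooth_fun A. x (f * g) = f u * x g + g u * x f) \<and>
     (\<forall>f. f \<notin> smooth_fun A \<longrightarrow> x f = 0)}"

definition vfields :: "('p, 'a::euclidean_space) chart set \<Rightarrow> 'p vfield set" where
  "vfields A = {X.
     (\<forall>f\<in>smooth_fun A. X f \<in> smooth_fun A) \<and>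
     (\<forall>f\<in>smooth_fun A. \<forall>g\<in>smooth_fun A. X (f + g) = X f + X g) \<and>
     (\<forall>f\<in>smooth_fun A. \<forall>r. X (\<lambda>p. r * f p) = (\<lambda>p. r * X f p)) \<and>
     (\<forall>f\<in>smooth_fun A. \<forall>g\<in>smooth_fun A. X (f * g) = f * X g + g * X f) \<and>
     (\<forall>f. f \<notin> smooth_fun A \<longrightarrow> X f = 0)}"

definition val :: "'p vfield \<Rightarrow> 'p \<Rightarrow> 'p tvec" where
  "val X u = (\<lambda>f. X f u)"

definition smul :: "('p \<Rightarrow> real) \<Rightarrow> 'p vfield \<Rightarrow> 'p vfield" (infixr "\<cdot>" 75) where
  "f \<cdot> X = (\<lambda>g. f * X g)"

definition lie :: "'p vfield \<Rightarrow> 'p vfield \<Rightarrow> 'p vfield" where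
  "lie X Y = (\<lambda>f. X (Y f) - Y (X f))"

definition tscale :: "real \<Rightarrow> 'p tvec \<Rightarrow> 'p tvec" where
  "tscale r x = (\<lambda>f. r * x f)"

global_interpretation tv: vector_space "tscale :: real \<Rightarrow> 'p tvec \<Rightarrow> 'p tvec"
  by unfold_locales (auto simp: tscale_def fun_eq_iff algebra_simps)


section \<open>Vertical bundle and nonlinear connection\<close>

text \<open>The kernel of the differential of the projection.\<close>

definition vertical ::
  "('b, 'c::euclidean_space) chart set \<Rightarrow> ('e, 'a::euclidean_space) chart set \<Rightarrow>
   ('e \<Rightarrow> 'b) \<Rightarrow> 'e dist" where
  "vertical AB AT \<pi> u = {x \<in> tangent_space AT u. \<forall>f\<in>smooth_fun AB. x (f \<circ> \<pi>) = 0}"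

text \<open>
  Smooth distribution of rank \<open>CARD('n)\<close>: it has local frames of smooth vector fields.  Taking the
  members of a local frame to be defined on all of the manifold is no restriction, because \<open>U\<close>
  may be shrunk.
\<close>

definition smooth_distribution ::
  "'n::finite itself \<Rightarrow> ('p::topological_space, 'a::euclidean_space) chart set \<Rightarrow>
   'p dist \<Rightarrow> bool" where
  "smooth_distribution N A H \<longleftrightarrow>
     (\<forall>u. H u \<subseteq> tangent_space A u \<and> tv.subspace (H u)) \<and>
     (\<forall>u. \<exists>U (X :: 'n \<Rightarrow> 'p vfield). open U \<and> u \<in> U \<and> range X \<subseteq> vfields A \<and>
        (\<forall>w\<in>U. inj (\<lambda>i. val (X i) w) \<and>
               tv.independent (range (\<lambda>i. val (X i) w)) \<and>
               tv.span (range (\<lambda>i. val (X i) w)) = H w))"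

definition nonlinear_connection ::
  "('b::topological_space, real^'n) chart set \<Rightarrow>
   ('e::topological_space, (real^'n) \<times> (real^'m)) chart set \<Rightarrow> ('e \<Rightarrow> 'b) \<Rightarrow> 'e dist \<Rightarrow> bool" where
  "nonlinear_connection AB AT \<pi> H \<longleftrightarrow>
     smooth_distribution TYPE('n) AT H \<and>
     (\<forall>u. H u \<inter> vertical AB AT \<pi> u = {0} \<and>
          (\<forall>x\<in>tangent_space AT u. \<exists>y\<in>H u. \<exists>z\<in>vertical AB AT \<pi> u. x = y + z))"

text \<open>
  From here on \<open>A\<close> is the atlas of the total space, \<open>H\<close> and \<open>V\<close> are the horizontal and the
  vertical distribution; \<open>hor H V\<close> and \<open>ver H V\<close> are the projectors onto them.
\<close>

definition hor :: "'p dist \<Rightarrow> 'p dist \<Rightarrow> 'p vfield \<Rightarrow> 'p vfield" where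
  "hor H V X = (\<lambda>f u. (THE y. y \<in> H u \<and> val X u - y \<in> V u) f)"

definition ver :: "'p dist \<Rightarrow> 'p dist \<Rightarrow> 'p vfield \<Rightarrow> 'p vfield" where
  "ver H V X = (\<lambda>f u. (THE z. z \<in> V u \<and> val X u - z \<in> H u) f)"

definition sections ::
  "('p, 'a::euclidean_space) chart set \<Rightarrow> 'p dist \<Rightarrow> 'p vfield set" where
  "sections A H = {X \<in> vfields A. \<forall>u. val X u \<in> H u}"


section \<open>Tensor fields\<close>

definition one_form ::
  "('p, 'a::euclidean_space) chart set \<Rightarrow> ('p vfield \<Rightarrow> 'p \<Rightarrow> real) \<Rightarrow> bool" where
  "one_form A \<omega> \<longleftrightarrow>
     (\<forall>X\<in>vfields A. \<omega> X \<in> smooth_fun A) \<and>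
     (\<forall>X\<in>vfields A. \<forall>Y\<in>vfields A. \<omega> (X + Y) = \<omega> X + \<omega> Y) \<and>
     (\<forall>f\<in>smooth_fun A. \<forall>X\<in>vfields A. \<omega> (f \<cdot> X) = f * \<omega> X)"

definition tensor11 ::
  "('p, 'a::euclidean_space) chart set \<Rightarrow> ('p vfield \<Rightarrow> 'p vfield) \<Rightarrow> bool" where
  "tensor11 A \<phi> \<longleftrightarrow>
     (\<forall>X\<in>vfields A. \<phi> X \<in> vfields A) \<and>
     (\<forall>X\<in>vfields A. \<forall>Y\<in>vfields A. \<phi> (X + Y) = \<phi> X + \<phi> Y) \<and>
     (\<forall>f\<in>smooth_fun A. \<forall>X\<in>vfields A. \<phi> (f \<cdot> X) = f \<cdot> \<phi> X)"

definition symmetric_tensor02 ::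
  "('p, 'a::euclidean_space) chart set \<Rightarrow>
   ('p vfield \<Rightarrow> 'p vfield \<Rightarrow> 'p \<Rightarrow> real) \<Rightarrow> bool" where
  "symmetric_tensor02 A G \<longleftrightarrow>
     (\<forall>X\<in>vfields A. one_form A (G X)) \<and>
     (\<forall>X\<in>vfields A. \<forall>Y\<in>vfields A. G X Y = G Y X)"

definition ext_d :: "('p vfield \<Rightarrow> 'p \<Rightarrow> real) \<Rightarrow> 'p vfield \<Rightarrow> 'p vfield \<Rightarrow> 'p \<Rightarrow> real" where
  "ext_d \<omega> X Y = X (\<omega> Y) - Y (\<omega> X) - \<omega> (lie X Y)"

definition nijenhuis ::
  "('p vfield \<Rightarrow> 'p vfield) \<Rightarrow> 'p vfield \<Rightarrow> 'p vfield \<Rightarrow> 'p vfield" where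
  "nijenhuis \<phi> X Y =
     \<phi> (\<phi> (lie X Y)) + lie (\<phi> X) (\<phi> Y) - \<phi> (lie (\<phi> X) Y) - \<phi> (lie X (\<phi> Y))"

definition form_h ::
  "'p dist \<Rightarrow> 'p dist \<Rightarrow> ('p vfield \<Rightarrow> 'p \<Rightarrow> real) \<Rightarrow> 'p vfield \<Rightarrow> 'p \<Rightarrow> real" where
  "form_h H V \<omega> X = \<omega> (hor H V X)"

definition form_v ::
  "'p dist \<Rightarrow> 'p dist \<Rightarrow> ('p vfield \<Rightarrow> 'p \<Rightarrow> real) \<Rightarrow> 'p vfield \<Rightarrow> 'p \<Rightarrow> real" where
  "form_v H V \<omega> X = \<omega> (ver H V X)"

definition tensor_h ::
  "'p dist \<Rightarrow> 'p dist \<Rightarrow> ('p vfield \<Rightarrow> 'p vfield \<Rightarrow> 'p \<Rightarrow> real) \<Rightarrow>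
   'p vfield \<Rightarrow> 'p vfield \<Rightarrow> 'p \<Rightarrow> real" where
  "tensor_h H V G X Y = G (hor H V X) (hor H V Y)"

definition tensor_v ::
  "'p dist \<Rightarrow> 'p dist \<Rightarrow> ('p vfield \<Rightarrow> 'p vfield \<Rightarrow> 'p \<Rightarrow> real) \<Rightarrow>
   'p vfield \<Rightarrow> 'p vfield \<Rightarrow> 'p \<Rightarrow> real" where
  "tensor_v H V G X Y = G (ver H V X) (ver H V Y)"

text \<open>
  Non-degeneracy on each subspace \<open>W u\<close> of the tangent space at \<open>u\<close>; tangent vectors enter as the
  values at \<open>u\<close> of sections of \<open>W\<close>.
\<close>

definition nondegenerate_on ::
  "('p, 'a::euclidean_space) chart set \<Rightarrow> 'p dist \<Rightarrow>
   ('p vfield \<Rightarrow> 'p vfield \<Rightarrow> 'p \<Rightarrow> real) \<Rightarrow> bool" where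
  "nondegenerate_on A W G \<longleftrightarrow>
     (\<forall>u. \<forall>X\<in>sections A W. (\<forall>Y\<in>sections A W. G X Y u = 0) \<longrightarrow> val X u = 0)"


section \<open>Para-Sasakian Finsler structures\<close>

definition almost_paracontact_Finsler ::
  "('p, 'a::euclidean_space) chart set \<Rightarrow> 'p dist \<Rightarrow> 'p dist \<Rightarrow>
   ('p vfield \<Rightarrow> 'p vfield) \<Rightarrow> ('p vfield \<Rightarrow> 'p \<Rightarrow> real) \<Rightarrow> 'p vfield \<Rightarrow> bool" where
  "almost_paracontact_Finsler A H V \<phi> \<eta> \<xi> \<longleftrightarrow>
     tensor11 A \<phi> \<and> one_form A \<eta> \<and> \<xi> \<in> vfields A \<and>
     \<phi> ` sections A H \<subseteq> sections A H \<and> \<phi> ` sections A V \<subseteq> sections A V \<and>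
     (\<forall>X\<in>vfields A. \<phi> (\<phi> X) =
        X - form_h H V \<eta> X \<cdot> hor H V \<xi> - form_v H V \<eta> X \<cdot> ver H V \<xi>) \<and>
     form_h H V \<eta> (hor H V \<xi>) = 1 \<and> form_v H V \<eta> (ver H V \<xi>) = 1"

definition normal_structure ::
  "('p, 'a::euclidean_space) chart set \<Rightarrow> 'p dist \<Rightarrow> 'p dist \<Rightarrow>
   ('p vfield \<Rightarrow> 'p vfield) \<Rightarrow> ('p vfield \<Rightarrow> 'p \<Rightarrow> real) \<Rightarrow> 'p vfield \<Rightarrow> bool" where
  "normal_structure A H V \<phi> \<eta> \<xi> \<longleftrightarrow>
     (\<forall>X\<in>vfields A. \<forall>Y\<in>vfields A.
        nijenhuis \<phi> X Y - ext_d (form_h H V \<eta>) X Y \<cdot> hor H V \<xi>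
                        - ext_d (form_v H V \<eta>) X Y \<cdot> ver H V \<xi> = 0)"

definition pseudo_metric_structure ::
  "('p, 'a::euclidean_space) chart set \<Rightarrow> 'p dist \<Rightarrow> 'p dist \<Rightarrow>
   ('p vfield \<Rightarrow> 'p vfield \<Rightarrow> 'p \<Rightarrow> real) \<Rightarrow> bool" where
  "pseudo_metric_structure A H V G \<longleftrightarrow>
     symmetric_tensor02 A G \<and> nondegenerate_on A (tangent_space A) G \<and>
     (\<forall>X\<in>vfields A. \<forall>Y\<in>vfields A. G X Y = tensor_h H V G X Y + tensor_v H V G X Y) \<and>
     nondegenerate_on A H (tensor_h H V G) \<and> nondegenerate_on A V (tensor_v H V G)"

definition almost_paracontact_metric_Finsler ::
  "('p, 'a::euclidean_space) chart set \<Rightarrow> 'p dist \<Rightarrow> 'p dist \<Rightarrow>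
   ('p vfield \<Rightarrow> 'p vfield) \<Rightarrow> ('p vfield \<Rightarrow> 'p \<Rightarrow> real) \<Rightarrow> 'p vfield \<Rightarrow>
   ('p vfield \<Rightarrow> 'p vfield \<Rightarrow> 'p \<Rightarrow> real) \<Rightarrow> bool" where
  "almost_paracontact_metric_Finsler A H V \<phi> \<eta> \<xi> G \<longleftrightarrow>
     almost_paracontact_Finsler A H V \<phi> \<eta> \<xi> \<and> pseudo_metric_structure A H V G \<and>
     (\<forall>X\<in>vfields A. \<forall>Y\<in>vfields A.
        tensor_h H V G (\<phi> X) (\<phi> Y) =
          - tensor_h H V G X Y + form_h H V \<eta> X * form_h H V \<eta> Y \<and>
        tensor_v H V G (\<phi> X) (\<phi> Y) =
          - tensor_v H V G X Y + form_v H V \<eta> X * form_v H V \<eta> Y)"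

definition fundamental_form ::
  "('p vfield \<Rightarrow> 'p vfield) \<Rightarrow> ('p vfield \<Rightarrow> 'p vfield \<Rightarrow> 'p \<Rightarrow> real) \<Rightarrow>
   'p vfield \<Rightarrow> 'p vfield \<Rightarrow> 'p \<Rightarrow> real" where
  "fundamental_form \<phi> G X Y = G X (\<phi> Y)"

definition paracontact_metric_Finsler ::
  "('p, 'a::euclidean_space) chart set \<Rightarrow> 'p dist \<Rightarrow> 'p dist \<Rightarrow>
   ('p vfield \<Rightarrow> 'p vfield) \<Rightarrow> ('p vfield \<Rightarrow> 'p \<Rightarrow> real) \<Rightarrow> 'p vfield \<Rightarrow>
   ('p vfield \<Rightarrow> 'p vfield \<Rightarrow> 'p \<Rightarrow> real) \<Rightarrow> bool" where
  "paracontact_metric_Finsler A H V \<phi> \<eta> \<xi> G \<longleftrightarrow>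
     almost_paracontact_metric_Finsler A H V \<phi> \<eta> \<xi> G \<and>
     (\<forall>X\<in>vfields A. \<forall>Y\<in>vfields A.
        ext_d (form_h H V \<eta>) X Y = fundamental_form \<phi> G (hor H V X) (hor H V Y) \<and>
        ext_d (form_v H V \<eta>) X Y = fundamental_form \<phi> G (ver H V X) (ver H V Y))"

definition para_Sasakian_Finsler ::
  "('p, 'a::euclidean_space) chart set \<Rightarrow> 'p dist \<Rightarrow> 'p dist \<Rightarrow>
   ('p vfield \<Rightarrow> 'p vfield) \<Rightarrow> ('p vfield \<Rightarrow> 'p \<Rightarrow> real) \<Rightarrow> 'p vfield \<Rightarrow>
   ('p vfield \<Rightarrow> 'p vfield \<Rightarrow> 'p \<Rightarrow> real) \<Rightarrow> bool" where
  "para_Sasakian_Finsler A H V \<phi> \<eta> \<xi> G \<longleftrightarrow>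
     paracontact_metric_Finsler A H V \<phi> \<eta> \<xi> G \<and> normal_structure A H V \<phi> \<eta> \<xi>"


section \<open>Finsler connections and curvature\<close>

definition linear_connection ::
  "('p, 'a::euclidean_space) chart set \<Rightarrow> ('p vfield \<Rightarrow> 'p vfield \<Rightarrow> 'p vfield) \<Rightarrow> bool" where
  "linear_connection A D \<longleftrightarrow>
     (\<forall>X\<in>vfields A. \<forall>Y\<in>vfields A. D X Y \<in> vfields A) \<and>
     (\<forall>X\<in>vfields A. \<forall>Y\<in>vfields A. \<forall>Z\<in>vfields A.
        D (X + Y) Z = D X Z + D Y Z \<and> D X (Y + Z) = D X Y + D X Z) \<and>
     (\<forall>f\<in>smooth_fun A. \<forall>X\<in>vfields A. \<forall>Y\<in>vfields A.
        D (f \<cdot> X) Y = f \<cdot> D X Y \<and> D X (f \<cdot> Y) = X f \<cdot> Y + f \<cdot> D X Y)"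

text \<open>\<open>D h = 0 = D v\<close> for the projectors \<open>h\<close>, \<open>v\<close>.\<close>

definition d_connection ::
  "('p, 'a::euclidean_space) chart set \<Rightarrow> 'p dist \<Rightarrow> 'p dist \<Rightarrow>
   ('p vfield \<Rightarrow> 'p vfield \<Rightarrow> 'p vfield) \<Rightarrow> bool" where
  "d_connection A H V D \<longleftrightarrow>
     linear_connection A D \<and>
     (\<forall>X\<in>vfields A. \<forall>Y\<in>vfields A.
        D X (hor H V Y) - hor H V (D X Y) = 0 \<and> D X (ver H V Y) - ver H V (D X Y) = 0)"

definition metrical ::
  "('p, 'a::euclidean_space) chart set \<Rightarrow> ('p vfield \<Rightarrow> 'p vfield \<Rightarrow> 'p \<Rightarrow> real) \<Rightarrow>
   ('p vfield \<Rightarrow> 'p vfield \<Rightarrow> 'p vfield) \<Rightarrow> bool" where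
  "metrical A G D \<longleftrightarrow>
     (\<forall>X\<in>vfields A. \<forall>Y\<in>vfields A. \<forall>Z\<in>vfields A.
        X (G Y Z) - G (D X Y) Z - G Y (D X Z) = 0)"

definition symmetric_connection ::
  "('p, 'a::euclidean_space) chart set \<Rightarrow> 'p dist \<Rightarrow> 'p dist \<Rightarrow>
   ('p vfield \<Rightarrow> 'p vfield \<Rightarrow> 'p vfield) \<Rightarrow> bool" where
  "symmetric_connection A H V D \<longleftrightarrow>
     (\<forall>X\<in>vfields A. \<forall>Y\<in>vfields A.
        D (hor H V X) (hor H V Y) - D (hor H V Y) (hor H V X)
          - hor H V (lie (hor H V X) (hor H V Y)) = 0 \<and>
        D (ver H V X) (ver H V Y) - D (ver H V Y) (ver H V X)
          - ver H V (lie (ver H V X) (ver H V Y)) = 0)"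

definition Finsler_connection ::
  "('p, 'a::euclidean_space) chart set \<Rightarrow> 'p dist \<Rightarrow> 'p dist \<Rightarrow>
   ('p vfield \<Rightarrow> 'p vfield \<Rightarrow> 'p \<Rightarrow> real) \<Rightarrow> ('p vfield \<Rightarrow> 'p vfield \<Rightarrow> 'p vfield) \<Rightarrow> bool" where
  "Finsler_connection A H V G D \<longleftrightarrow>
     d_connection A H V D \<and> metrical A G D \<and> symmetric_connection A H V D"

definition curvature ::
  "('p vfield \<Rightarrow> 'p vfield \<Rightarrow> 'p vfield) \<Rightarrow>
   'p vfield \<Rightarrow> 'p vfield \<Rightarrow> 'p vfield \<Rightarrow> 'p vfield" where
  "curvature D X Y Z = D X (D Y Z) - D Y (D X Z) - D (lie X Y) Z"

definition locally_symmetric ::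
  "('p, 'a::euclidean_space) chart set \<Rightarrow>
   ('p vfield \<Rightarrow> 'p vfield \<Rightarrow> 'p vfield) \<Rightarrow> bool" where
  "locally_symmetric A D \<longleftrightarrow>
     (\<forall>W\<in>vfields A. \<forall>X\<in>vfields A. \<forall>Y\<in>vfields A. \<forall>Z\<in>vfields A.
        D W (curvature D X Y Z) - curvature D (D W X) Y Z
          - curvature D X (D W Y) Z - curvature D X Y (D W Z) = 0)"


section \<open>Vertical flag curvature\<close>

text \<open>
  A vector of the vertical space at \<open>u\<close> enters as the value at \<open>u\<close> of a vertical vector field
  \<open>X\<close>; the quantities below are tensorial and depend on \<open>X\<close> only through \<open>val X u\<close>.  As \<open>G\<close> is
  indefinite, a unit vector may have square \<open>1\<close> or \<open>-1\<close>.
\<close>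

definition spans_vertical_phi_section ::
  "('p, 'a::euclidean_space) chart set \<Rightarrow> 'p dist \<Rightarrow> 'p dist \<Rightarrow>
   ('p vfield \<Rightarrow> 'p vfield) \<Rightarrow> 'p vfield \<Rightarrow> ('p vfield \<Rightarrow> 'p vfield \<Rightarrow> 'p \<Rightarrow> real) \<Rightarrow>
   'p \<Rightarrow> 'p tvec set \<Rightarrow> 'p vfield \<Rightarrow> bool" where
  "spans_vertical_phi_section A H V \<phi> \<xi> G u P X \<longleftrightarrow>
     P \<subseteq> V u \<and> tv.subspace P \<and> tv.dim P = 2 \<and>
     X \<in> sections A V \<and> \<bar>G X X u\<bar> = 1 \<and> G X (ver H V \<xi>) u = 0 \<and>
     P = tv.span {val X u, val (\<phi> X) u}"

definition flag_curvature ::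
  "('p vfield \<Rightarrow> 'p vfield \<Rightarrow> 'p \<Rightarrow> real) \<Rightarrow> ('p vfield \<Rightarrow> 'p vfield \<Rightarrow> 'p vfield) \<Rightarrow>
   'p vfield \<Rightarrow> 'p vfield \<Rightarrow> 'p \<Rightarrow> real" where
  "flag_curvature G D X Y u = G (curvature D X Y Y) X u / (G X X u * G Y Y u)"

definition has_vertical_phi_flag_curvature ::
  "('p, 'a::euclidean_space) chart set \<Rightarrow> 'p dist \<Rightarrow> 'p dist \<Rightarrow>
   ('p vfield \<Rightarrow> 'p vfield) \<Rightarrow> 'p vfield \<Rightarrow> ('p vfield \<Rightarrow> 'p vfield \<Rightarrow> 'p \<Rightarrow> real) \<Rightarrow>
   ('p vfield \<Rightarrow> 'p vfield \<Rightarrow> 'p vfield) \<Rightarrow> real \<Rightarrow> bool" where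
  "has_vertical_phi_flag_curvature A H V \<phi> \<xi> G D \<kappa> \<longleftrightarrow>
     (\<forall>u P X. spans_vertical_phi_section A H V \<phi> \<xi> G u P X \<longrightarrow>
        flag_curvature G D X (\<phi> X) u = \<kappa>)"

end

theory Submission
  imports Defs
begin

text \<open>
  Vertical vector fields are closed under the Lie bracket, and on them the given data reduce to an
  ordinary para-Sasakian structure: \<open>D\<close> becomes a torsion-free metric connection, and
  \<open>d\<eta>(X, Y) = G(X, \<phi> Y)\<close>, \<open>N\<^sub>\<phi>(X, Y) = d\<eta>(X, Y) \<xi>\<close> hold with \<open>\<eta>\<close> and \<open>\<xi>\<close> replaced by their vertical
  parts.  The computation is then the one for a locally symmetric para-Sasakian manifold.

  \<^item> Normality says that the Lie derivative of \<open>\<phi>\<close> along \<open>\<xi>\<close> vanishes; as \<open>\<Phi> = d\<eta>\<close> is closed, \<open>\<xi>\<close>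
    is a Killing field (\<open>xi_Killing\<close>).  So \<open>d\<eta>(X, Y) = 2 G(D\<^sub>X \<xi>, Y)\<close>, that is
    \<open>D\<^sub>X \<xi> = - (1/2) \<phi> X\<close>.  The factor is there because \<open>d\<close> is normalised without \<open>1/2\<close>, and
    it is the reason for the value \<open>- 1/4\<close> in place of the usual \<open>- 1\<close>.
  \<^item> Closedness of \<open>\<Phi>\<close>, normality and the formula for \<open>\<phi>\<^sup>2\<close> determine the covariant derivative of
    \<open>\<phi>\<close> completely (\<open>nabla_Phi_formula\<close>), as in the proof that the complex
    structure of a Hermitian manifold is parallel if the fundamental form is closed.
    Up to a factor \<open>R(X, Y)\<xi>\<close> is the skew part of that derivative, so
    \<open>R(X, Y)\<xi> = - (1/4) (\<eta>(Y) X - \<eta>(X) Y)\<close> (\<open>curvature_xi\<close>).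
  \<^item> Differentiating this identity along \<open>W\<close> and using \<open>D R = 0\<close> replaces \<open>\<xi>\<close> by
    \<open>D\<^sub>W \<xi> = - (1/2) \<phi> W\<close> and gives
    \<open>R(X, Y) \<phi> W = - (1/4) (G(\<phi> W, Y) X - G(\<phi> W, X) Y)\<close> (\<open>curvature_phi\<close>).
    With \<open>W = X\<close> and \<open>Y = \<phi> X\<close> this is the flag curvature.

  These steps are algebra over the ring of smooth functions; a vertical vector field is recovered
  from its products with all vertical fields because \<open>G\<close> is non-degenerate on the vertical bundle.
  Local geometry enters at one point: the algebra needs the vertical part of \<open>\<xi>\<close> to be
  a smooth vector field.  The projectors are defined pointwise, so their smoothness has to be proved
  from local frames of the horizontal distribution (\<open>hor_vfield\<close>), which needs some calculus of
  smooth functions on manifolds.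
\<close>


section \<open>Functions of class \<open>C\<^sup>k\<close> on open subsets of Euclidean spaces\<close>

lemma frechet_derivative_cong_open:
  assumes "open S" "x \<in> S" "\<And>y. y \<in> S \<Longrightarrow> f y = g y" "f differentiable (at x)"
  shows "g differentiable (at x)" "frechet_derivative g (at x) = frechet_derivative f (at x)"
proof -
  have "(f has_derivative frechet_derivative f (at x)) (at x)"
    using assms(4) by (simp add: frechet_derivative_works)
  then have *: "(g has_derivative frechet_derivative f (at x)) (at x)"
    using has_derivative_transform_within_open[OF _ assms(1,2)] assms(3) by blast
  then show "g differentiable (at x)" by (auto simp: differentiable_def)
  show "frechet_derivative g (at x) = frechet_derivative f (at x)"
    using frechet_derivative_at[OF *] by simp
qed

text \<open>
  \<^const>\<open>Ck_on\<close> refers to derivatives at the points of \<open>S\<close>, which depend on a neighbourhood; for open \<open>S\<close>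
  the values on \<open>S\<close> still decide.
\<close>

lemma Ck_on_cong:
  assumes "open S" "\<And>x. x \<in> S \<Longrightarrow> f x = g x" "Ck_on k S f"
  shows "Ck_on k S g"
  using assms(2,3)
proof (induction k arbitrary: f g)
  case 0
  then show ?case by (metis Ck_on.simps(1) continuous_on_cong)
next
  case (Suc k)
  show ?case
    unfolding Ck_on.simps
  proof (intro conjI ballI allI)
    fix x assume "x \<in> S"
    then show "g differentiable (at x)"
      using frechet_derivative_cong_open(1)[OF assms(1) _ Suc.prems(1)] Suc.prems(2) by auto
  next
    fix v
    show "Ck_on k S (\<lambda>x. frechet_derivative g (at x) v)"
    proof (rule Suc.IH)
      show "Ck_on k S (\<lambda>x. frechet_derivative f (at x) v)" using Suc.prems by auto
      fix x assume "x \<in> S"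
      then show "frechet_derivative f (at x) v = frechet_derivative g (at x) v"
        using frechet_derivative_cong_open(2)[OF assms(1) _ Suc.prems(1)] Suc.prems(2) by auto
    qed
  qed
qed

lemma Ck_on_subset: "Ck_on k S f \<Longrightarrow> T \<subseteq> S \<Longrightarrow> Ck_on k T f"
proof (induction k arbitrary: f)
  case 0
  then show ?case by (simp add: continuous_on_subset)
next
  case (Suc k)
  then have "\<forall>x\<in>T. f differentiable (at x)" by auto
  moreover have "Ck_on k T (\<lambda>x. frechet_derivative f (at x) v)" for v
    using Suc by simp
  ultimately show ?case by simp
qed

lemma Ck_on_local:
  assumes "\<And>x. x \<in> S \<Longrightarrow> \<exists>T. open T \<and> x \<in> T \<and> Ck_on k T f"
  shows "Ck_on k S f"
  using assms
proof (induction k arbitrary: f)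
  case 0
  have "isCont f x" if "x \<in> S" for x
    using 0[OF that] by (auto simp: continuous_on_eq_continuous_at)
  then show ?case by (auto intro: continuous_at_imp_continuous_on)
next
  case (Suc k)
  have "f differentiable (at x)" if "x \<in> S" for x
    using Suc.prems[OF that] by auto
  moreover have "Ck_on k S (\<lambda>x. frechet_derivative f (at x) v)" for v
  proof (rule Suc.IH)
    fix x assume "x \<in> S"
    from Suc.prems[OF this] show
      "\<exists>T. open T \<and> x \<in> T \<and> Ck_on k T (\<lambda>x. frechet_derivative f (at x) v)" by auto
  qed
  ultimately show ?case by simp
qed

lemma Ck_on_lower: "Ck_on (Suc k) S f \<Longrightarrow> Ck_on k S f"
proof (induction k arbitrary: f)
  case 0
  then show ?case
    by (simp add: continuous_at_imp_continuous_on differentiable_imp_continuous_within)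
next
  case (Suc k)
  then show ?case by (metis Ck_on.simps(2))
qed

lemma Ck_on_const: "Ck_on k (S :: 'a::euclidean_space set) (\<lambda>x. c)"
proof (induction k arbitrary: c)
  case (Suc k)
  have "frechet_derivative (\<lambda>_. c) (at x) = (\<lambda>_. 0)" for x :: 'a
    using frechet_derivative_at[OF has_derivative_const] by metis
  with Suc show ?case by simp
qed simp

text \<open>
  With this rule the derivative of a sum, a product or an inverse is read off from the known
  derivative formulas, and closure under these operations follows by induction on \<open>k\<close>.
\<close>

lemma Ck_on_SucI:
  assumes "open S"
    and "\<And>x. x \<in> S \<Longrightarrow> (f has_derivative f' x) (at x)"
    and "\<And>v. Ck_on k S (\<lambda>x. f' x v)"
  shows "Ck_on (Suc k) S f"
  unfolding Ck_on.simps
proof (intro conjI ballI allI)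
  show "Ck_on k S (\<lambda>x. frechet_derivative f (at x) v)" for v
    by (rule Ck_on_cong[OF assms(1) _ assms(3)]) (simp add: frechet_derivative_at[OF assms(2)])
qed (use assms(2) in \<open>auto simp: differentiable_def\<close>)

lemma Ck_on_SucD:
  assumes "Ck_on (Suc k) S f" "x \<in> S"
  shows "(f has_derivative frechet_derivative f (at x)) (at x)"
  using assms frechet_derivative_works by auto

lemma Ck_on_add:
  assumes "open S" "Ck_on k S f" "Ck_on k S g"
  shows "Ck_on k S (\<lambda>x. f x + g x)"
  using assms(2,3)
proof (induction k arbitrary: f g)
  case 0
  then show ?case by (auto intro: continuous_on_add)
next
  case (Suc k)
  show ?case
  proof (rule Ck_on_SucI[OF assms(1)])
    show "((\<lambda>x. f x + g x) has_derivative
        (\<lambda>v. frechet_derivative f (at x) v + frechet_derivative g (at x) v)) (at x)"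
      if "x \<in> S" for x
      using Ck_on_SucD[OF Suc.prems(1) that] Ck_on_SucD[OF Suc.prems(2) that]
      by (rule has_derivative_add)
    show "Ck_on k S (\<lambda>x. frechet_derivative f (at x) v + frechet_derivative g (at x) v)" for v
      using Suc by simp
  qed
qed

lemma Ck_on_mult:
  fixes f g :: "'a::euclidean_space \<Rightarrow> real"
  assumes "open S" "Ck_on k S f" "Ck_on k S g"
  shows "Ck_on k S (\<lambda>x. f x * g x)"
  using assms(2,3)
proof (induction k arbitrary: f g)
  case 0
  then show ?case by (auto intro: continuous_on_mult)
next
  case (Suc k)
  show ?case
  proof (rule Ck_on_SucI[OF assms(1)])
    show "((\<lambda>x. f x * g x) has_derivative
        (\<lambda>v. f x * frechet_derivative g (at x) v + frechet_derivative f (at x) v * g x)) (at x)"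
      if "x \<in> S" for x
      using Ck_on_SucD[OF Suc.prems(1) that] Ck_on_SucD[OF Suc.prems(2) that]
      by (rule has_derivative_mult)
    show "Ck_on k S
        (\<lambda>x. f x * frechet_derivative g (at x) v + frechet_derivative f (at x) v * g x)" for v
      using Suc.prems Ck_on_lower[OF Suc.prems(1)] Ck_on_lower[OF Suc.prems(2)]
      by (intro Ck_on_add[OF assms(1)] Suc.IH) simp_all
  qed
qed

lemma Ck_on_inverse:
  fixes f :: "'a::euclidean_space \<Rightarrow> real"
  assumes "open S" "\<And>x. x \<in> S \<Longrightarrow> f x \<noteq> 0" "Ck_on k S f"
  shows "Ck_on k S (\<lambda>x. inverse (f x))"
  using assms(3)
proof (induction k)
  case 0
  then show ?case using assms(2) by (auto intro: continuous_on_inverse)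
next
  case (Suc k)
  have inv: "Ck_on k S (\<lambda>x. inverse (f x))" using Suc Ck_on_lower by blast
  have df: "Ck_on k S (\<lambda>x. frechet_derivative f (at x) v)" for v using Suc.prems by simp
  show ?case
  proof (rule Ck_on_SucI[OF assms(1)])
    show "((\<lambda>x. inverse (f x)) has_derivative
        (\<lambda>v. -1 * (inverse (f x) * frechet_derivative f (at x) v * inverse (f x)))) (at x)"
      if "x \<in> S" for x
      using Deriv.has_derivative_inverse[OF assms(2)[OF that] Ck_on_SucD[OF Suc.prems that]] by simp
    show "Ck_on k S
        (\<lambda>x. -1 * (inverse (f x) * frechet_derivative f (at x) v * inverse (f x)))" for v
      by (intro Ck_on_mult[OF assms(1)] Ck_on_const inv df)
  qed
qed

section \<open>Smooth functions on open sets of a manifold\<close>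

text \<open>
  The coefficients of a vector field in a local frame are smooth only where the frame exists, so
  smoothness is needed relative to an open set \<open>N\<close>.
\<close>

definition smooth_fun_on ::
  "('p, 'a::euclidean_space) chart set \<Rightarrow> 'p set \<Rightarrow> ('p \<Rightarrow> real) set" where
  "smooth_fun_on A N = {f. \<forall>(U, c)\<in>A. smooth_on (c ` (U \<inter> N)) (f \<circ> inv_into U c)}"

lemma smooth_fun_on_iff:
  "f \<in> smooth_fun_on A N \<longleftrightarrow>
     (\<forall>U c k. (U, c) \<in> A \<longrightarrow> Ck_on k (c ` (U \<inter> N)) (f \<circ> inv_into U c))"
  by (auto simp: smooth_fun_on_def smooth_on_def)

lemma smooth_fun_onD:
  "f \<in> smooth_fun_on A N \<Longrightarrow> (U, c) \<in> A \<Longrightarrow> Ck_on k (c ` (U \<inter> N)) (f \<circ> inv_into U c)"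
  by (simp add: smooth_fun_on_iff)

lemma smooth_fun_on_UNIV: "smooth_fun_on A UNIV = smooth_fun A"
  by (simp add: smooth_fun_on_def smooth_fun_def)

lemma smooth_fun_on_mono: "f \<in> smooth_fun_on A N \<Longrightarrow> M \<subseteq> N \<Longrightarrow> f \<in> smooth_fun_on A M"
  unfolding smooth_fun_on_iff by (blast intro: Ck_on_subset)

lemma smooth_fun_on_const: "(\<lambda>_. r) \<in> smooth_fun_on A N"
  by (auto simp: smooth_fun_on_def smooth_on_def o_def Ck_on_const)

lemma chart_image_open:
  assumes "smooth_atlas A" "(U, c) \<in> A" "open N"
  shows "open (c ` (U \<inter> N))"
proof -
  have *: "open U" "open (c ` U)" "homeomorphism U (c ` U) c (inv_into U c)"
    using assms by (auto simp: smooth_atlas_def is_chart_def)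
  have "openin (top_of_set (c ` U)) (c ` (U \<inter> N))"
    using homeomorphism_imp_open_map[OF *(3)] assms(3) by (simp add: openin_open_Int)
  then show ?thesis using *(2) openin_open_trans by blast
qed

lemma inv_chart:
  assumes "smooth_atlas A" "(U, c) \<in> A" "p \<in> U"
  shows "inv_into U c (c p) = p"
  using assms by (auto simp: smooth_atlas_def is_chart_def homeomorphism_def)

lemma smooth_fun_on_cong:
  assumes "smooth_atlas A" "open N" "\<And>p. p \<in> N \<Longrightarrow> f p = g p" "f \<in> smooth_fun_on A N"
  shows "g \<in> smooth_fun_on A N"
  unfolding smooth_fun_on_iff
proof (clarify)
  fix U c k assume K: "(U, c) \<in> A"
  show "Ck_on k (c ` (U \<inter> N)) (g \<circ> inv_into U c)"
  proof (rule Ck_on_cong[OF chart_image_open[OF assms(1) K assms(2)]])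
    show "Ck_on k (c ` (U \<inter> N)) (f \<circ> inv_into U c)"
      using assms(4) K by (simp add: smooth_fun_on_iff)
  qed (use assms(3) inv_chart[OF assms(1) K] in auto)
qed

lemma smooth_fun_local:
  assumes "smooth_atlas A" "\<And>u. \<exists>N. open N \<and> u \<in> N \<and> f \<in> smooth_fun_on A N"
  shows "f \<in> smooth_fun A"
  unfolding smooth_fun_def smooth_on_def
proof (clarify)
  fix U c k assume K: "(U, c) \<in> A"
  show "Ck_on k (c ` U) (f \<circ> inv_into U c)"
  proof (rule Ck_on_local)
    fix x assume "x \<in> c ` U"
    then obtain p where p: "p \<in> U" "x = c p" by auto
    obtain N where N: "open N" "p \<in> N" "f \<in> smooth_fun_on A N" using assms(2) by blast
    show "\<exists>T. open T \<and> x \<in> T \<and> Ck_on k T (f \<circ> inv_into U c)"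
      using chart_image_open[OF assms(1) K N(1)] N p K
      by (intro exI[of _ "c ` (U \<inter> N)"]) (auto simp: smooth_fun_on_iff)
  qed
qed

lemma smooth_fun_on_add:
  assumes "smooth_atlas A" "open N" "f \<in> smooth_fun_on A N" "g \<in> smooth_fun_on A N"
  shows "(\<lambda>p. f p + g p) \<in> smooth_fun_on A N"
  unfolding smooth_fun_on_iff
proof (clarify)
  fix U c k assume K: "(U, c) \<in> A"
  from Ck_on_add[OF chart_image_open[OF assms(1) K assms(2)]
      smooth_fun_onD[OF assms(3) K] smooth_fun_onD[OF assms(4) K]]
  show "Ck_on k (c ` (U \<inter> N)) ((\<lambda>p. f p + g p) \<circ> inv_into U c)"
    unfolding o_def .
qed

lemma smooth_fun_on_mult:
  assumes "smooth_atlas A" "open N" "f \<in> smooth_fun_on A N" "g \<in> smooth_fun_on A N"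
  shows "(\<lambda>p. f p * g p) \<in> smooth_fun_on A N"
  unfolding smooth_fun_on_iff
proof (clarify)
  fix U c k assume K: "(U, c) \<in> A"
  from Ck_on_mult[OF chart_image_open[OF assms(1) K assms(2)]
      smooth_fun_onD[OF assms(3) K] smooth_fun_onD[OF assms(4) K]]
  show "Ck_on k (c ` (U \<inter> N)) ((\<lambda>p. f p * g p) \<circ> inv_into U c)"
    unfolding o_def .
qed

lemma smooth_fun_on_divide:
  assumes "smooth_atlas A" "open N" "f \<in> smooth_fun_on A N" "g \<in> smooth_fun_on A N"
    and "\<And>p. p \<in> N \<Longrightarrow> g p \<noteq> 0"
  shows "(\<lambda>p. f p / g p) \<in> smooth_fun_on A N"
proof -
  have "(\<lambda>p. inverse (g p)) \<in> smooth_fun_on A N"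
    unfolding smooth_fun_on_iff
  proof (clarify)
    fix U c k assume K: "(U, c) \<in> A"
    have "Ck_on k (c ` (U \<inter> N)) (g \<circ> inv_into U c)"
      using assms(4) K by (simp add: smooth_fun_on_iff)
    moreover have "(g \<circ> inv_into U c) x \<noteq> 0" if "x \<in> c ` (U \<inter> N)" for x
      using that assms(5) inv_chart[OF assms(1) K] by auto
    ultimately have "Ck_on k (c ` (U \<inter> N)) (\<lambda>x. inverse ((g \<circ> inv_into U c) x))"
      by (intro Ck_on_inverse[OF chart_image_open[OF assms(1) K assms(2)]])
    then show "Ck_on k (c ` (U \<inter> N)) ((\<lambda>p. inverse (g p)) \<circ> inv_into U c)"
      by (simp add: o_def)
  qed
  from smooth_fun_on_mult[OF assms(1-3) this] show ?thesis by (simp add: divide_inverse)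
qed

lemma smooth_fun_on_sum:
  assumes "smooth_atlas A" "open N" "\<And>i. i \<in> I \<Longrightarrow> f i \<in> smooth_fun_on A N"
  shows "(\<lambda>p. \<Sum>i\<in>I. f i p) \<in> smooth_fun_on A N"
  using assms(3)
proof (induction I rule: infinite_finite_induct)
  case (insert i I)
  then show ?case
    using smooth_fun_on_add[OF assms(1,2), of "f i" "\<lambda>p. \<Sum>i\<in>I. f i p"] by simp
qed (simp_all add: smooth_fun_on_const)

lemma smooth_fun_on_prod:
  assumes "smooth_atlas A" "open N" "\<And>i. i \<in> I \<Longrightarrow> f i \<in> smooth_fun_on A N"
  shows "(\<lambda>p. \<Prod>i\<in>I. f i p) \<in> smooth_fun_on A N"
  using assms(3)
proof (induction I rule: infinite_finite_induct)
  case (insert i I)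
  then show ?case
    using smooth_fun_on_mult[OF assms(1,2), of "f i" "\<lambda>p. \<Prod>i\<in>I. f i p"] by simp
qed (simp_all add: smooth_fun_on_const)

lemma smooth_fun_on_det:
  assumes "smooth_atlas A" "open N" "\<And>i j. M i j \<in> smooth_fun_on A N"
  shows "(\<lambda>p. det (\<chi> i j. M i j p)) \<in> smooth_fun_on A N"
proof -
  have "(\<lambda>q. of_int (sign p) * (\<Prod>i\<in>UNIV. M i (p i) q)) \<in> smooth_fun_on A N" for p
    using smooth_fun_on_mult[OF assms(1,2) smooth_fun_on_const
        smooth_fun_on_prod[OF assms(1,2), of UNIV "\<lambda>i. M i (p i)"]] assms(3) by blast
  then show ?thesis
    using smooth_fun_on_sum[OF assms(1,2), of "{p. p permutes UNIV}"
        "\<lambda>p q. of_int (sign p) * (\<Prod>i\<in>UNIV. M i (p i) q)"]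
    by (simp add: det_def)
qed

lemma smooth_fun_continuous:
  assumes "smooth_atlas A" "f \<in> smooth_fun A"
  shows "continuous_on UNIV f"
proof (intro continuous_at_imp_continuous_on ballI)
  fix u
  have "u \<in> (\<Union>K\<in>A. fst K)" using assms(1) by (simp add: smooth_atlas_def)
  then obtain U c where K: "(U, c) \<in> A" "u \<in> U" by (metis UN_E prod.collapse)
  have *: "open U" "homeomorphism U (c ` U) c (inv_into U c)"
    using assms(1) K by (auto simp: smooth_atlas_def is_chart_def)
  have "Ck_on 0 (c ` U) (f \<circ> inv_into U c)"
    using smooth_fun_onD[of f A UNIV U c 0] assms(2) K by (simp add: smooth_fun_on_UNIV)
  then have "continuous_on (c ` U) (f \<circ> inv_into U c)" by simp
  then have "continuous_on U ((f \<circ> inv_into U c) \<circ> c)"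
    using *(2) by (metis continuous_on_compose homeomorphism_cont1)
  then have "continuous_on U f"
    by (rule continuous_on_eq) (simp add: inv_chart[OF assms(1) K(1)])
  then show "isCont f u" using *(1) K by (simp add: continuous_on_eq_continuous_at)
qed

lemma smooth_fun_const: "(\<lambda>_. r) \<in> smooth_fun A"
  using smooth_fun_on_const[of r A UNIV] by (simp add: smooth_fun_on_UNIV)

lemma smooth_fun_add:
  assumes "smooth_atlas A" "f \<in> smooth_fun A" "g \<in> smooth_fun A"
  shows "f + g \<in> smooth_fun A"
  using smooth_fun_on_add[of A UNIV f g] assms by (simp add: smooth_fun_on_UNIV plus_fun_def)

lemma smooth_fun_mult:
  assumes "smooth_atlas A" "f \<in> smooth_fun A" "g \<in> smooth_fun A"
  shows "f * g \<in> smooth_fun A"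
  using smooth_fun_on_mult[of A UNIV f g] assms by (simp add: smooth_fun_on_UNIV times_fun_def)

lemma smooth_fun_diff:
  assumes "smooth_atlas A" "f \<in> smooth_fun A" "g \<in> smooth_fun A"
  shows "f - g \<in> smooth_fun A"
proof -
  have "f - g = f + (\<lambda>_. - 1) * g" by (auto simp: fun_eq_iff)
  also have "\<dots> \<in> smooth_fun A"
    by (intro smooth_fun_add smooth_fun_mult smooth_fun_const assms)
  finally show ?thesis .
qed


section \<open>Vector fields\<close>

lemma val_apply: "val X u f = X f u"
  by (simp add: val_def)

lemma sum_fun_apply: "(\<Sum>i\<in>I. F i) x = (\<Sum>i\<in>I. F i x)"
  by (induction I rule: infinite_finite_induct) simp_all

lemma vfield_eqI: "(\<And>u. val X u = val Y u) \<Longrightarrow> X = Y"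
  by (metis ext val_apply)

lemma tangent_space_subspace: "tv.subspace (tangent_space A u)"
  by (auto simp: tv.subspace_def tangent_space_def tscale_def algebra_simps)

lemma vfield_val: "X \<in> vfields A \<Longrightarrow> val X u \<in> tangent_space A u"
  by (simp add: vfields_def tangent_space_def val_def)

lemma vfieldI:
  assumes "\<And>u. val X u \<in> tangent_space A u" "\<And>f. f \<in> smooth_fun A \<Longrightarrow> X f \<in> smooth_fun A"
  shows "X \<in> vfields A"
  using assms by (auto simp: vfields_def tangent_space_def val_def fun_eq_iff)

lemma vfield_smooth: "X \<in> vfields A \<Longrightarrow> f \<in> smooth_fun A \<Longrightarrow> X f \<in> smooth_fun A"
  by (simp add: vfields_def)

lemma vfield_apply_add:
  "X \<in> vfields A \<Longrightarrow> f \<in> smooth_fun A \<Longrightarrow> g \<in> smooth_fun A \<Longrightarrow> X (f + g) = X f + X g"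
  by (simp add: vfields_def)

lemma vfield_apply_mult:
  "X \<in> vfields A \<Longrightarrow> f \<in> smooth_fun A \<Longrightarrow> g \<in> smooth_fun A \<Longrightarrow> X (f * g) = f * X g + g * X f"
  by (simp add: vfields_def)

lemma vfield_apply_scale:
  "X \<in> vfields A \<Longrightarrow> f \<in> smooth_fun A \<Longrightarrow> X (\<lambda>p. r * f p) = (\<lambda>p. r * X f p)"
  by (simp add: vfields_def)

lemma vfield_apply_nonsmooth: "X \<in> vfields A \<Longrightarrow> f \<notin> smooth_fun A \<Longrightarrow> X f = 0"
  by (simp add: vfields_def)

lemma vfield_apply_const:
  assumes "X \<in> vfields A"
  shows "X (\<lambda>_. r) = 0"
proof -
  have "X (\<lambda>_. r) = X (\<lambda>p. r * (\<lambda>_. 1) p)" by simp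
  also have "\<dots> = (\<lambda>p. r * X (\<lambda>_. 1) p)"
    by (rule vfield_apply_scale[OF assms smooth_fun_const])
  finally have r: "X (\<lambda>_. r) = (\<lambda>p. r * X (\<lambda>_. 1) p)" .
  have "X ((\<lambda>_. 1) * (\<lambda>_. 1)) = (\<lambda>_. 1) * X (\<lambda>_. 1) + (\<lambda>_. 1) * X (\<lambda>_. 1)"
    by (rule vfield_apply_mult[OF assms smooth_fun_const smooth_fun_const])
  then have "X (\<lambda>_. 1) = 0" by (simp add: fun_eq_iff times_fun_def)
  with r show ?thesis by (simp add: fun_eq_iff)
qed

lemma vfield_apply_diff:
  assumes "smooth_atlas A" "X \<in> vfields A" "f \<in> smooth_fun A" "g \<in> smooth_fun A"
  shows "X (f - g) = X f - X g"
  using vfield_apply_add[OF assms(2) smooth_fun_diff[OF assms(1,3,4)] assms(4)] by simp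

lemma vfields_add:
  assumes "smooth_atlas A" "X \<in> vfields A" "Y \<in> vfields A"
  shows "X + Y \<in> vfields A"
proof (rule vfieldI)
  have "val (X + Y) u = val X u + val Y u" for u by (simp add: val_def plus_fun_def)
  then show "val (X + Y) u \<in> tangent_space A u" for u
    using tv.subspace_add[OF tangent_space_subspace] assms vfield_val by metis
qed (simp add: smooth_fun_add vfield_smooth assms)

lemma vfields_smul:
  assumes "smooth_atlas A" "f \<in> smooth_fun A" "X \<in> vfields A"
  shows "f \<cdot> X \<in> vfields A"
proof (rule vfieldI)
  have "val (f \<cdot> X) u = tscale (f u) (val X u)" for u
    by (simp add: val_def smul_def tscale_def)
  then show "val (f \<cdot> X) u \<in> tangent_space A u" for u
    using tv.subspace_scale[OF tangent_space_subspace] assms vfield_val by metis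
qed (simp add: smooth_fun_mult vfield_smooth assms smul_def)

lemma uminus_eq_smul: "- X = (\<lambda>_. - 1) \<cdot> (X :: 'p vfield)"
  by (simp add: fun_eq_iff smul_def)

lemma vfields_diff:
  assumes "smooth_atlas A" "X \<in> vfields A" "Y \<in> vfields A"
  shows "X - Y \<in> vfields A"
  using vfields_add[OF assms(1,2) vfields_smul[OF assms(1) smooth_fun_const assms(3)], of "- 1"]
  by (simp flip: uminus_eq_smul)

lemma vfields_lie:
  assumes A: "smooth_atlas A" and X: "X \<in> vfields A" and Y: "Y \<in> vfields A"
  shows "lie X Y \<in> vfields A"
proof -
  note sm = vfield_smooth[OF X] vfield_smooth[OF Y] smooth_fun_add[OF A] smooth_fun_mult[OF A]
  have nonsmooth: "X (Y f) = 0 \<and> Y (X f) = 0" if "f \<notin> smooth_fun A" for f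
    using vfield_apply_nonsmooth[OF X that] vfield_apply_nonsmooth[OF Y that]
      vfield_apply_const[OF X, of 0] vfield_apply_const[OF Y, of 0] by (simp add: zero_fun_def)
  show ?thesis
    unfolding vfields_def
  proof (intro CollectI conjI ballI allI impI)
    fix f assume f: "f \<in> smooth_fun A"
    then show "lie X Y f \<in> smooth_fun A"
      by (simp add: lie_def sm smooth_fun_diff[OF A])
    show "lie X Y (\<lambda>p. r * f p) = (\<lambda>p. r * lie X Y f p)" for r
      using f by (simp add: lie_def vfield_apply_scale[OF X] vfield_apply_scale[OF Y] sm
          fun_eq_iff algebra_simps)
    fix g assume g: "g \<in> smooth_fun A"
    show "lie X Y (f + g) = lie X Y f + lie X Y g"
      using f g by (simp add: lie_def vfield_apply_add[OF X] vfield_apply_add[OF Y] sm)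
    show "lie X Y (f * g) = f * lie X Y g + g * lie X Y f"
      using f g by (simp add: lie_def vfield_apply_add[OF X] vfield_apply_add[OF Y]
          vfield_apply_mult[OF X] vfield_apply_mult[OF Y] sm algebra_simps)
  qed (simp add: lie_def nonsmooth)
qed

section \<open>Complementary distributions\<close>

text \<open>
  The two projectors are interchanged by exchanging the distributions; every result about \<^const>\<open>hor\<close> thus
  covers \<^const>\<open>ver\<close> as well.
\<close>

lemma ver_eq_hor: "ver H V = hor V H"
  by (simp add: ver_def hor_def fun_eq_iff)

locale complementary_distributions =
  fixes A :: "('p::{second_countable_topology, t2_space}, 'a::euclidean_space) chart set"
    and H V :: "'p dist"
  assumes atlas: "smooth_atlas A"
    and H_tangent: "H u \<subseteq> tangent_space A u" and V_tangent: "V u \<subseteq> tangent_space A u"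
    and H_subspace: "tv.subspace (H u)" and V_subspace: "tv.subspace (V u)"
    and trivial_Int: "H u \<inter> V u = {0}"
    and decompose: "x \<in> tangent_space A u \<Longrightarrow> \<exists>y\<in>H u. \<exists>z\<in>V u. x = y + z"
begin

lemma swap: "complementary_distributions A V H"
  using atlas H_tangent V_tangent H_subspace V_subspace trivial_Int decompose
  by unfold_locales (auto simp: Int_commute, metis add.commute)

lemma ex1_component:
  assumes "X \<in> vfields A"
  shows "\<exists>!y. y \<in> H u \<and> val X u - y \<in> V u"
proof -
  obtain y z where yz: "y \<in> H u" "z \<in> V u" "val X u = y + z"
    using decompose[OF vfield_val[OF assms]] by blast
  have "y' = y" if "y' \<in> H u" "val X u - y' \<in> V u" for y'
  proof -
    have "y' - y \<in> H u" using tv.subspace_diff[OF H_subspace] that yz by blast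
    moreover have "y' - y = z - (val X u - y')" using yz by simp
    then have "y' - y \<in> V u" using tv.subspace_diff[OF V_subspace] that yz by metis
    ultimately have "y' - y \<in> H u \<inter> V u" by blast
    then show ?thesis using trivial_Int by simp
  qed
  then show ?thesis using yz by (intro ex1I[of _ y]) auto
qed

lemma val_hor:
  assumes "X \<in> vfields A"
  shows "val (hor H V X) u \<in> H u" "val X u - val (hor H V X) u \<in> V u"
proof -
  have "val (hor H V X) u = (THE y. y \<in> H u \<and> val X u - y \<in> V u)"
    by (rule ext) (simp add: val_apply hor_def)
  with theI'[OF ex1_component[OF assms, of u]]
  show "val (hor H V X) u \<in> H u" "val X u - val (hor H V X) u \<in> V u" by auto
qed

lemma hor_eqI:
  assumes "X \<in> vfields A" "\<And>u. val Y u \<in> H u" "\<And>u. val X u - val Y u \<in> V u"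
  shows "hor H V X = Y"
  using ex1_component[OF assms(1)] val_hor[OF assms(1)] assms(2,3) by (intro vfield_eqI) blast

lemma hor_of_H: "X \<in> sections A H \<Longrightarrow> hor H V X = X"
  by (rule hor_eqI) (auto simp: sections_def tv.subspace_0[OF V_subspace])

lemma hor_of_V:
  assumes "X \<in> sections A V"
  shows "hor H V X = 0"
proof (rule hor_eqI)
  have val0: "val (0 :: 'p vfield) u = 0" for u by (simp add: val_def fun_eq_iff)
  show "val (0 :: 'p vfield) u \<in> H u" "val X u - val (0 :: 'p vfield) u \<in> V u" for u
    using assms tv.subspace_0[OF H_subspace, of u] val0 by (auto simp: sections_def)
qed (use assms in \<open>simp add: sections_def\<close>)

end

text \<open>
  The vectors \<open>(x\<^sub>i(g))\<^sub>i\<close> with \<open>g \<in> Q\<close> span the whole coordinate space, since a vector orthogonal to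
  all of them is a linear relation between the \<open>x\<^sub>i\<close> on \<open>Q\<close>; a basis chosen among them gives the rows
  of the matrix.
\<close>

lemma exists_matrix_of_functionals:
  fixes x :: "'n::finite \<Rightarrow> 'q \<Rightarrow> real"
  assumes "\<And>c. \<forall>g\<in>Q. (\<Sum>i\<in>UNIV. c i * x i g) = 0 \<Longrightarrow> \<forall>i. c i = 0"
  obtains g :: "'n \<Rightarrow> 'q" where "range g \<subseteq> Q" "det (\<chi> i j. x j (g i)) \<noteq> 0"
proof -
  let ?v = "\<lambda>g. (\<chi> i. x i g) :: real^'n"
  have span: "span (?v ` Q) = UNIV"
  proof (rule ccontr)
    assume "span (?v ` Q) \<noteq> UNIV"
    then obtain a where a: "a \<noteq> 0" "\<forall>y\<in>span (?v ` Q). a \<bullet> y = 0"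
      using span_not_UNIV_orthogonal by blast
    have "(\<Sum>i\<in>UNIV. a $ i * x i g) = 0" if "g \<in> Q" for g
      using a(2) span_base[of "?v g" "?v ` Q"] that by (auto simp: inner_vec_def)
    then have "\<forall>i. a $ i = 0" using assms[of "\<lambda>i. a $ i"] by blast
    then show False using a(1) by (simp add: vec_eq_iff)
  qed
  obtain B where B: "B \<subseteq> ?v ` Q" "independent B" "?v ` Q \<subseteq> span B" "card B = dim (?v ` Q)"
    using basis_exists by blast
  have card: "card B = CARD('n)"
    using B(4) span by (metis dim_span dim_UNIV DIM_cart DIM_real mult.right_neutral)
  have spanB: "span B = UNIV"
    using span span_mono[OF B(3)] by (simp add: span_span top.extremum_unique)
  have "finite B" using card by (metis card.infinite zero_less_card_finite less_numeral_extra(3))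
  then obtain b :: "'n \<Rightarrow> real^'n" where b: "bij_betw b UNIV B"
    using finite_same_card_bij[of "UNIV :: 'n set" B] card by auto
  have "\<forall>i. \<exists>g\<in>Q. b i = ?v g" using b B(1) by (auto simp: bij_betw_def)
  then obtain g where g: "\<And>i. g i \<in> Q" "\<And>i. b i = ?v (g i)" by metis
  let ?M = "(\<chi> i j. x j (g i)) :: real^'n^'n"
  have "row i ?M = b i" for i by (simp add: row_def g(2) vec_eq_iff)
  then have "rows ?M = B" using b by (auto simp: rows_def bij_betw_def)
  then have "\<exists>M'. M' ** ?M = mat 1" using spanB matrix_left_invertible_span_rows by blast
  then have "det ?M \<noteq> 0" using invertible_det_nz invertible_left_inverse by blast
  then show ?thesis using that g(1) by blast
qed

text \<open>
  Here \<open>V\<close> is the annihilator of a set \<open>Q\<close> of functions; for the vertical bundle, \<open>Q\<close> consists of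
  the functions lifted from the base.  Let \<open>E\<^sub>1, \<dots>, E\<^sub>n\<close> be a frame of \<open>H\<close> near \<open>u\<close>.  A combination of
  the \<open>E\<^sub>j(u)\<close> that kills \<open>Q\<close> lies in \<open>H \<inter> V\<close> and so vanishes; hence there are \<open>g\<^sub>1, \<dots>, g\<^sub>n \<in> Q\<close> for
  which the matrix \<open>E\<^sub>j g\<^sub>i\<close> is invertible at \<open>u\<close>, and then also near \<open>u\<close>.  As \<open>X\<close> and
  its component in \<open>H\<close> agree on the \<open>g\<^sub>i\<close>, the coefficients \<open>a\<^sub>j\<close> of that component solve the linear system
  \<open>\<Sum>\<^sub>j a\<^sub>j E\<^sub>j g\<^sub>i = X g\<^sub>i\<close> and are smooth by Cramer's rule.  Choosing the \<open>g\<^sub>i\<close> by linear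
  algebra avoids coordinate functions and their extension by bump functions.
\<close>

lemma (in complementary_distributions) hor_vfield:
  assumes frame: "smooth_distribution TYPE('n::finite) A H"
    and ann: "\<And>u. V u = {x \<in> tangent_space A u. \<forall>g\<in>Q. x g = 0}"
    and X: "X \<in> vfields A"
  shows "hor H V X \<in> vfields A"
proof (rule vfieldI)
  show "val (hor H V X) u \<in> tangent_space A u" for u
    using val_hor(1)[OF X] H_tangent by blast
  fix f assume f: "f \<in> smooth_fun A"
  show "hor H V X f \<in> smooth_fun A"
  proof (rule smooth_fun_local[OF atlas])
    fix u
    obtain U and E :: "'n \<Rightarrow> 'p vfield" where U: "open U" "u \<in> U" and E: "range E \<subseteq> vfields A"
      and basis: "\<And>w. w \<in> U \<Longrightarrow> inj (\<lambda>i. val (E i) w)"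
        "\<And>w. w \<in> U \<Longrightarrow> tv.independent (range (\<lambda>i. val (E i) w))"
        "\<And>w. w \<in> U \<Longrightarrow> tv.span (range (\<lambda>i. val (E i) w)) = H w"
      using frame unfolding smooth_distribution_def by metis
    have Evf: "E i \<in> vfields A" for i using E by blast
    have comb: "(\<Sum>v\<in>range (\<lambda>i. val (E i) w). tscale (c v) v) =
        (\<Sum>i\<in>UNIV. tscale (c (val (E i) w)) (val (E i) w))" if "w \<in> U" for c w
      using sum.reindex[OF basis(1)[OF that], of "\<lambda>v. tscale (c v) v"] by (simp add: o_def)
    obtain g :: "'n \<Rightarrow> 'p \<Rightarrow> real" where g: "range g \<subseteq> Q"
      and det: "det (\<chi> i j. E j (g i) u) \<noteq> 0"
    proof (rule exists_matrix_of_functionals[of Q "\<lambda>i f. E i f u"])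
      fix c :: "'n \<Rightarrow> real" assume c: "\<forall>g\<in>Q. (\<Sum>i\<in>UNIV. c i * E i g u) = 0"
      let ?y = "\<Sum>i\<in>UNIV. tscale (c i) (val (E i) u)"
      have "?y \<in> tv.span (range (\<lambda>i. val (E i) u))"
        by (intro tv.span_sum tv.span_scale tv.span_base) simp
      then have H: "?y \<in> H u" using basis(3)[OF U(2)] by simp
      moreover have "?y \<in> V u"
        using H H_tangent c unfolding ann by (auto simp: sum_fun_apply tscale_def val_apply)
      ultimately have 0: "?y = 0" using trivial_Int by blast
      show "\<forall>i. c i = 0"
      proof (rule ccontr)
        assume "\<not> (\<forall>i. c i = 0)"
        then obtain i where i: "c i \<noteq> 0" by blast
        let ?c = "\<lambda>v. c (inv (\<lambda>i. val (E i) u) v)"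
        have inv: "?c (val (E i) u) = c i" for i
          using inv_f_f[OF basis(1)[OF U(2)]] by simp
        have "(\<Sum>v\<in>range (\<lambda>i. val (E i) u). tscale (?c v) v) = 0"
          using comb[OF U(2), of ?c] 0 inv by simp
        moreover have "\<exists>v\<in>range (\<lambda>i. val (E i) u). ?c v \<noteq> 0" using i inv by force
        ultimately have "tv.dependent (range (\<lambda>i. val (E i) u))"
          using tv.dependent_finite[of "range (\<lambda>i. val (E i) u)"] by auto
        with basis(2)[OF U(2)] show False by simp
      qed
    qed auto
    \<comment> \<open>Vector fields are \<open>0\<close> on functions that are not smooth, so such a \<open>g i\<close> would give a zero row.\<close>
    have gs: "g i \<in> smooth_fun A" for i
    proof (rule ccontr)
      assume "g i \<notin> smooth_fun A"
      then have "row i (\<chi> i j. E j (g i) u) = 0"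
        using vfield_apply_nonsmooth[OF Evf] by (simp add: row_def vec_eq_iff)
      with det show False using det_zero_row(1) by blast
    qed
    define M where "M = (\<lambda>w. (\<chi> i j. E j (g i) w) :: real^'n^'n)"
    define C where "C = (\<lambda>k w. (\<chi> i j. (if j = k then X else E j) (g i) w) :: real^'n^'n)"
    define N where "N = U \<inter> {w. det (M w) \<noteq> 0}"
    have detM: "(\<lambda>w. det (M w)) \<in> smooth_fun A"
      unfolding M_def smooth_fun_on_UNIV[symmetric]
      by (intro smooth_fun_on_det atlas open_UNIV)
        (simp add: smooth_fun_on_UNIV vfield_smooth[OF Evf gs])
    have detC: "(\<lambda>w. det (C k w)) \<in> smooth_fun A" for k
      unfolding C_def smooth_fun_on_UNIV[symmetric]
      by (intro smooth_fun_on_det atlas open_UNIV)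
        (simp add: smooth_fun_on_UNIV vfield_smooth[OF Evf gs] vfield_smooth[OF X gs])
    have "open {w. det (M w) \<noteq> 0}"
      using smooth_fun_continuous[OF atlas detM] open_Collect_neq continuous_on_const by blast
    then have N: "open N" "u \<in> N" using U det by (auto simp: N_def M_def)
    have cramer_hor: "hor H V X f w = (\<Sum>k\<in>UNIV. det (C k w) / det (M w) * E k f w)" if "w \<in> N" for w
    proof -
      have w: "w \<in> U" "det (M w) \<noteq> 0" using that by (auto simp: N_def)
      have "val (hor H V X) w \<in> tv.span (range (\<lambda>i. val (E i) w))"
        using val_hor(1)[OF X] basis(3)[OF w(1)] by simp
      then obtain c where "val (hor H V X) w = (\<Sum>v\<in>range (\<lambda>i. val (E i) w). tscale (c v) v)"
        by (auto simp: tv.span_finite)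
      then obtain a where a: "val (hor H V X) w = (\<Sum>i\<in>UNIV. tscale (a i) (val (E i) w))"
        using comb[OF w(1), of c] that[of "\<lambda>i. c (val (E i) w)"] by simp
      then have val: "hor H V X h w = (\<Sum>i\<in>UNIV. a i * E i h w)" for h
        unfolding val_apply[symmetric, of "hor H V X"] a by (simp only: val_apply sum_fun_apply tscale_def)
      have "X (g i) w = hor H V X (g i) w" for i
      proof -
        have "(val X w - val (hor H V X) w) (g i) = 0"
          using val_hor(2)[OF X, of w] g unfolding ann by blast
        then show ?thesis by (simp add: val_apply)
      qed
      then have "M w *v (\<chi> k. a k) = (\<chi> i. X (g i) w)"
        by (simp add: matrix_vector_mult_def M_def vec_eq_iff val mult.commute)
      then have "(\<chi> k. a k) =
          (\<chi> k. det (\<chi> i j. if j = k then (\<chi> i. X (g i) w) $ i else M w $ i $ j) / det (M w))"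
        using cramer[OF w(2)] by blast
      moreover have "(\<chi> i j. if j = k then (\<chi> i. X (g i) w) $ i else M w $ i $ j) = C k w" for k
        by (simp add: C_def M_def vec_eq_iff)
      ultimately have "a k = det (C k w) / det (M w)" for k
        by (simp add: vec_eq_iff)
      then show ?thesis using val by simp
    qed
    have "(\<lambda>w. \<Sum>k\<in>UNIV. det (C k w) / det (M w) * E k f w) \<in> smooth_fun_on A N"
    proof (intro smooth_fun_on_sum smooth_fun_on_mult smooth_fun_on_divide atlas N)
      show "det (M w) \<noteq> 0" if "w \<in> N" for w using that by (simp add: N_def)
    qed (use detM detC vfield_smooth[OF Evf f] smooth_fun_on_mono[of _ A UNIV N] in
        \<open>simp_all add: smooth_fun_on_UNIV\<close>)
    then have "hor H V X f \<in> smooth_fun_on A N"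
      by (rule smooth_fun_on_cong[OF atlas N(1), rotated]) (simp add: cramer_hor)
    with N show "\<exists>N. open N \<and> u \<in> N \<and> hor H V X f \<in> smooth_fun_on A N" by blast
  qed
qed


section \<open>Curvature of a para-Sasakian structure\<close>

lemma lie_apply: "lie X Y f = X (Y f) - Y (X f)"
  by (simp add: lie_def)

lemma smul_one: "1 \<cdot> X = X"
  by (simp add: smul_def fun_eq_iff)

lemma smul_zero_left: "0 \<cdot> X = 0" "(\<lambda>_. 0) \<cdot> X = 0"
  by (simp_all add: smul_def fun_eq_iff)

lemma smul_zero_right: "f \<cdot> 0 = 0"
  by (simp add: smul_def fun_eq_iff)

lemma lie_jacobi:
  assumes A: "smooth_atlas A" and XYZ: "X \<in> vfields A" "Y \<in> vfields A" "Z \<in> vfields A"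
  shows "lie (lie X Y) Z + lie (lie Y Z) X + lie (lie Z X) Y = 0"
proof
  fix f
  show "(lie (lie X Y) Z + lie (lie Y Z) X + lie (lie Z X) Y) f = 0 f"
  proof (cases "f \<in> smooth_fun A")
    case True
    then show ?thesis
      using XYZ by (simp add: lie_def vfield_apply_diff[OF A] vfield_smooth fun_eq_iff)
  next
    case False
    have "lie (lie X Y) Z \<in> vfields A" "lie (lie Y Z) X \<in> vfields A" "lie (lie Z X) Y \<in> vfields A"
      using XYZ by (auto intro!: vfields_lie[OF A])
    then show ?thesis using False by (simp add: vfield_apply_nonsmooth fun_eq_iff)
  qed
qed

text \<open>
  The properties of vertical vector fields on which the curvature computation rests: \<open>L\<close> is a
  submodule of the vector fields that is closed under the Lie bracket, with a torsion-free metric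
  connection and a para-Sasakian structure on it.
\<close>

locale para_Sasakian_algebra =
  fixes A :: "('p::{second_countable_topology, t2_space}, 'a::euclidean_space) chart set"
    and L :: "'p vfield set"
    and \<phi> :: "'p vfield \<Rightarrow> 'p vfield" and \<eta> :: "'p vfield \<Rightarrow> 'p \<Rightarrow> real" and \<xi> :: "'p vfield"
    and G :: "'p vfield \<Rightarrow> 'p vfield \<Rightarrow> 'p \<Rightarrow> real"
    and D :: "'p vfield \<Rightarrow> 'p vfield \<Rightarrow> 'p vfield"
  assumes atlas: "smooth_atlas A"
    and L_vfields: "X \<in> L \<Longrightarrow> X \<in> vfields A"
    and L_add: "X \<in> L \<Longrightarrow> Y \<in> L \<Longrightarrow> X + Y \<in> L"
    and L_smul: "f \<in> smooth_fun A \<Longrightarrow> X \<in> L \<Longrightarrow> f \<cdot> X \<in> L"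
    and L_lie: "X \<in> L \<Longrightarrow> Y \<in> L \<Longrightarrow> lie X Y \<in> L"
    and D_closed: "X \<in> L \<Longrightarrow> Y \<in> L \<Longrightarrow> D X Y \<in> L"
    and D_add_left: "X \<in> L \<Longrightarrow> Y \<in> L \<Longrightarrow> Z \<in> L \<Longrightarrow> D (X + Y) Z = D X Z + D Y Z"
    and D_add_right: "X \<in> L \<Longrightarrow> Y \<in> L \<Longrightarrow> Z \<in> L \<Longrightarrow> D X (Y + Z) = D X Y + D X Z"
    and D_smul_left: "f \<in> smooth_fun A \<Longrightarrow> X \<in> L \<Longrightarrow> Y \<in> L \<Longrightarrow> D (f \<cdot> X) Y = f \<cdot> D X Y"
    and D_smul_right:
      "f \<in> smooth_fun A \<Longrightarrow> X \<in> L \<Longrightarrow> Y \<in> L \<Longrightarrow> D X (f \<cdot> Y) = X f \<cdot> Y + f \<cdot> D X Y"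
    and torsion_free: "X \<in> L \<Longrightarrow> Y \<in> L \<Longrightarrow> lie X Y = D X Y - D Y X"
    and G_parallel:
      "X \<in> L \<Longrightarrow> Y \<in> L \<Longrightarrow> Z \<in> L \<Longrightarrow> X (G Y Z) = G (D X Y) Z + G Y (D X Z)"
    and G_smooth: "X \<in> L \<Longrightarrow> Y \<in> L \<Longrightarrow> G X Y \<in> smooth_fun A"
    and G_add_left: "X \<in> L \<Longrightarrow> Y \<in> L \<Longrightarrow> Z \<in> L \<Longrightarrow> G (X + Y) Z = G X Z + G Y Z"
    and G_smul_left: "f \<in> smooth_fun A \<Longrightarrow> X \<in> L \<Longrightarrow> Y \<in> L \<Longrightarrow> G (f \<cdot> X) Y = f * G X Y"
    and G_sym: "X \<in> L \<Longrightarrow> Y \<in> L \<Longrightarrow> G X Y = G Y X"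
    and G_nondegenerate: "X \<in> L \<Longrightarrow> (\<And>Y. Y \<in> L \<Longrightarrow> G X Y = 0) \<Longrightarrow> X = 0"
    and phi_closed: "X \<in> L \<Longrightarrow> \<phi> X \<in> L"
    and phi_add: "X \<in> L \<Longrightarrow> Y \<in> L \<Longrightarrow> \<phi> (X + Y) = \<phi> X + \<phi> Y"
    and phi_smul: "f \<in> smooth_fun A \<Longrightarrow> X \<in> L \<Longrightarrow> \<phi> (f \<cdot> X) = f \<cdot> \<phi> X"
    and xi_closed: "\<xi> \<in> L"
    and eta_smooth: "X \<in> L \<Longrightarrow> \<eta> X \<in> smooth_fun A"
    and eta_add: "X \<in> L \<Longrightarrow> Y \<in> L \<Longrightarrow> \<eta> (X + Y) = \<eta> X + \<eta> Y"
    and eta_smul: "f \<in> smooth_fun A \<Longrightarrow> X \<in> L \<Longrightarrow> \<eta> (f \<cdot> X) = f * \<eta> X"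
    and phi_phi: "X \<in> L \<Longrightarrow> \<phi> (\<phi> X) = X - \<eta> X \<cdot> \<xi>"
    and eta_xi: "\<eta> \<xi> = 1"
    and G_phi_phi: "X \<in> L \<Longrightarrow> Y \<in> L \<Longrightarrow> G (\<phi> X) (\<phi> Y) = - G X Y + \<eta> X * \<eta> Y"
    and contact: "X \<in> L \<Longrightarrow> Y \<in> L \<Longrightarrow> ext_d \<eta> X Y = G X (\<phi> Y)"
    and normal: "X \<in> L \<Longrightarrow> Y \<in> L \<Longrightarrow> nijenhuis \<phi> X Y = G X (\<phi> Y) \<cdot> \<xi>"
begin

lemma L_uminus: "X \<in> L \<Longrightarrow> - X \<in> L"
  by (simp add: uminus_eq_smul L_smul smooth_fun_const)

lemma L_diff: "X \<in> L \<Longrightarrow> Y \<in> L \<Longrightarrow> X - Y \<in> L"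
  using L_add[of X "- Y"] L_uminus by simp

lemma L_zero: "0 \<in> L"
  using L_diff[OF xi_closed xi_closed] by simp

lemmas closed = L_vfields L_add L_smul L_lie L_diff L_zero D_closed phi_closed xi_closed
  G_smooth eta_smooth smooth_fun_const vfield_smooth
  smooth_fun_add[OF atlas] smooth_fun_diff[OF atlas] smooth_fun_mult[OF atlas]

lemma apply_const: "X \<in> L \<Longrightarrow> X (\<lambda>_. r) = 0"
  using vfield_apply_const L_vfields by blast

lemma apply_uminus: "X \<in> L \<Longrightarrow> f \<in> smooth_fun A \<Longrightarrow> X (- f) = - X f"
  using vfield_apply_diff[OF atlas L_vfields smooth_fun_const, of X f 0] apply_const[of X 0]
  by (simp add: zero_fun_def[symmetric])

lemma D_diff_left: "X \<in> L \<Longrightarrow> Y \<in> L \<Longrightarrow> Z \<in> L \<Longrightarrow> D (X - Y) Z = D X Z - D Y Z"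
  using D_add_left[of "X - Y" Y Z] by (simp add: closed)

lemma D_diff_right: "X \<in> L \<Longrightarrow> Y \<in> L \<Longrightarrow> Z \<in> L \<Longrightarrow> D X (Y - Z) = D X Y - D X Z"
  using D_add_right[of X "Y - Z" Z] by (simp add: closed)

lemma D_zero: "X \<in> L \<Longrightarrow> D X 0 = 0" "X \<in> L \<Longrightarrow> D 0 X = 0"
  using D_diff_right[of X 0 0] D_diff_left[of 0 0 X] by (simp_all add: closed)

lemma D_smul_const: "X \<in> L \<Longrightarrow> Y \<in> L \<Longrightarrow> D X ((\<lambda>_. r) \<cdot> Y) = (\<lambda>_. r) \<cdot> D X Y"
  by (simp only: D_smul_right smooth_fun_const apply_const smul_zero_left add_0)

lemma G_diff_left: "X \<in> L \<Longrightarrow> Y \<in> L \<Longrightarrow> Z \<in> L \<Longrightarrow> G (X - Y) Z = G X Z - G Y Z"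
  using G_add_left[of "X - Y" Y Z] by (simp add: closed)

lemma G_add_right: "X \<in> L \<Longrightarrow> Y \<in> L \<Longrightarrow> Z \<in> L \<Longrightarrow> G X (Y + Z) = G X Y + G X Z"
  using G_add_left[of Y Z X] by (simp add: closed G_sym[of X])

lemma G_diff_right: "X \<in> L \<Longrightarrow> Y \<in> L \<Longrightarrow> Z \<in> L \<Longrightarrow> G X (Y - Z) = G X Y - G X Z"
  using G_diff_left[of Y Z X] by (simp add: closed G_sym[of X])

lemma G_smul_right: "f \<in> smooth_fun A \<Longrightarrow> X \<in> L \<Longrightarrow> Y \<in> L \<Longrightarrow> G X (f \<cdot> Y) = f * G X Y"
  using G_smul_left[of f Y X] by (simp add: closed G_sym[of X])

lemma G_zero: "X \<in> L \<Longrightarrow> G X 0 = 0" "X \<in> L \<Longrightarrow> G 0 X = 0"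
  using G_diff_right[of X 0 0] G_diff_left[of 0 0 X] by (simp_all add: closed)

lemma phi_diff: "X \<in> L \<Longrightarrow> Y \<in> L \<Longrightarrow> \<phi> (X - Y) = \<phi> X - \<phi> Y"
  using phi_add[of "X - Y" Y] by (simp add: closed)

lemma phi_zero: "\<phi> 0 = 0"
  using phi_diff[OF L_zero L_zero] by simp

lemma G_uminus_right: "X \<in> L \<Longrightarrow> Y \<in> L \<Longrightarrow> G X (- Y) = - G X Y"
  using G_diff_right[of X 0 Y] by (simp add: closed G_zero)

lemma phi_uminus: "X \<in> L \<Longrightarrow> \<phi> (- X) = - \<phi> X"
  using phi_diff[of 0 X] by (simp add: closed phi_zero)

lemma eta_diff: "X \<in> L \<Longrightarrow> Y \<in> L \<Longrightarrow> \<eta> (X - Y) = \<eta> X - \<eta> Y"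
  using eta_add[of "X - Y" Y] by (simp add: closed)

lemma eta_zero: "\<eta> 0 = 0"
  using eta_diff[OF L_zero L_zero] by simp

lemmas linear = D_add_left D_add_right D_smul_left D_smul_right D_diff_left D_diff_right D_zero
  G_add_left G_smul_left G_diff_left G_add_right G_diff_right G_smul_right G_zero
  phi_add phi_smul phi_diff phi_zero eta_add eta_smul eta_diff eta_zero
  G_uminus_right phi_uminus smul_one smul_zero_left smul_zero_right

text \<open>
  Since \<open>\<phi> (\<phi> \<xi>) = 0\<close>, the formula for \<open>\<phi>\<^sup>2\<close> at \<open>\<phi> \<xi>\<close> gives \<open>\<phi> \<xi> = a \<xi>\<close>; applying \<open>\<phi>\<close> once more gives
  \<open>a\<^sup>2 = 0\<close>.
\<close>

lemma phi_xi: "\<phi> \<xi> = 0"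
proof -
  let ?a = "\<eta> (\<phi> \<xi>)"
  have 0: "\<phi> (\<phi> \<xi>) = 0" using phi_phi[OF xi_closed] by (simp add: eta_xi linear)
  then have xi: "\<phi> \<xi> = ?a \<cdot> \<xi>" using phi_phi[of "\<phi> \<xi>"] by (simp add: closed linear)
  have "0 = \<eta> (\<phi> (?a \<cdot> \<xi>))" using 0 xi by (simp add: linear)
  also have "\<dots> = ?a * ?a" by (simp add: linear closed)
  finally have "?a = 0" by (auto simp: fun_eq_iff)
  with xi show ?thesis by (simp add: linear)
qed

text \<open>
  Compute \<open>\<phi>\<^sup>3 X\<close> as \<open>\<phi>\<close> of \<open>\<phi>\<^sup>2 X\<close> and as \<open>\<phi>\<^sup>2\<close> of \<open>\<phi> X\<close>.
\<close>

lemma eta_phi: assumes "X \<in> L" shows "\<eta> (\<phi> X) = 0"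
proof -
  have "\<phi> (\<phi> (\<phi> X)) = \<phi> X" using assms by (simp add: phi_phi linear closed phi_xi)
  moreover have "\<phi> (\<phi> (\<phi> X)) = \<phi> X - \<eta> (\<phi> X) \<cdot> \<xi>" using assms by (intro phi_phi) (simp add: closed)
  ultimately have "\<eta> (\<phi> X) \<cdot> \<xi> = 0" by simp
  then have "\<eta> (\<eta> (\<phi> X) \<cdot> \<xi>) = 0" by (simp add: linear)
  then show ?thesis using assms by (simp add: linear closed eta_xi)
qed

lemma G_xi: "X \<in> L \<Longrightarrow> G X \<xi> = \<eta> X" "X \<in> L \<Longrightarrow> G \<xi> X = \<eta> X"
  using G_phi_phi[of X \<xi>] G_sym[of X \<xi>] by (simp_all add: phi_xi linear closed eta_xi)

lemma phi_skew: assumes "X \<in> L" "Y \<in> L" shows "G X (\<phi> Y) = - G (\<phi> X) Y"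
  using G_phi_phi[of X "\<phi> Y"] assms by (simp add: phi_phi linear closed eta_phi G_xi)

text \<open>
  The covariant derivatives of the tensors \<open>\<phi>\<close> and \<open>\<Phi>(Y, Z) = G(Y, \<phi> Z)\<close> in the direction \<open>X\<close>; the two
  are related in this way because \<open>G\<close> is parallel.
\<close>

definition nabla_phi where "nabla_phi X Y = D X (\<phi> Y) - \<phi> (D X Y)"

definition nabla_Phi where "nabla_Phi X Y Z = G Y (nabla_phi X Z)"

lemma nabla_phi_closed: "X \<in> L \<Longrightarrow> Y \<in> L \<Longrightarrow> nabla_phi X Y \<in> L"
  by (simp add: nabla_phi_def closed)

lemma D_phi: "D X (\<phi> Y) = nabla_phi X Y + \<phi> (D X Y)"
  by (simp add: nabla_phi_def)

lemma derivative_fundamental_form: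
  assumes "X \<in> L" "Y \<in> L" "Z \<in> L"
  shows "X (G Y (\<phi> Z)) = nabla_Phi X Y Z + G (D X Y) (\<phi> Z) + G Y (\<phi> (D X Z))"
  using assms by (simp add: G_parallel closed D_phi linear nabla_phi_closed nabla_Phi_def fun_eq_iff)

lemma nabla_Phi_skew:
  assumes "X \<in> L" "Y \<in> L" "Z \<in> L"
  shows "nabla_Phi X Y Z u = - nabla_Phi X Z Y u"
proof -
  have "X (G Y (\<phi> Z)) = X (- G Z (\<phi> Y))"
    using assms phi_skew[of Y Z] G_sym[of Z "\<phi> Y"] by (simp add: closed)
  also have "\<dots> = - X (G Z (\<phi> Y))"
    using assms by (simp add: closed apply_uminus fun_eq_iff)
  finally have "X (G Y (\<phi> Z)) u = - X (G Z (\<phi> Y)) u" by simp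
  moreover have "G (D X Y) (\<phi> Z) u = - G Z (\<phi> (D X Y)) u" "G (D X Z) (\<phi> Y) u = - G Y (\<phi> (D X Z)) u"
    using assms phi_skew[of "D X Y" Z] phi_skew[of "D X Z" Y] by (simp_all add: closed G_sym)
  ultimately show ?thesis using assms by (simp add: derivative_fundamental_form)
qed

lemma contact_apply:
  assumes "X \<in> L" "Y \<in> L"
  shows "G X (\<phi> Y) = X (\<eta> Y) - Y (\<eta> X) - \<eta> (lie X Y)"
  using contact[OF assms] by (simp add: ext_d_def)

text \<open>
  This is \<open>d\<Phi> = 0\<close>: as \<open>\<Phi> = d\<eta>\<close>, the exterior derivative of \<open>\<Phi>\<close> vanishes by the Jacobi
  identity, and for a torsion-free connection it is the cyclic sum of the covariant derivative.
\<close>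

lemma nabla_Phi_cyclic:
  assumes "X \<in> L" "Y \<in> L" "Z \<in> L"
  shows "nabla_Phi X Y Z u + nabla_Phi Y Z X u + nabla_Phi Z X Y u = 0"
proof -
  have d: "X (G Y (\<phi> Z)) = X (Y (\<eta> Z)) - X (Z (\<eta> Y)) - X (\<eta> (lie Y Z))"
    if "X \<in> L" "Y \<in> L" "Z \<in> L" for X Y Z
    using that by (simp add: contact_apply vfield_apply_diff[OF atlas] closed fun_eq_iff)
  have l: "G (lie X Y) (\<phi> Z) = X (Y (\<eta> Z)) - Y (X (\<eta> Z)) - Z (\<eta> (lie X Y)) - \<eta> (lie (lie X Y) Z)"
    if "X \<in> L" "Y \<in> L" "Z \<in> L" for X Y Z
    using that by (simp add: contact_apply closed lie_apply)
  have "\<eta> (lie (lie X Y) Z + lie (lie Y Z) X + lie (lie Z X) Y) u = 0"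
    using assms by (simp add: lie_jacobi[OF atlas] closed linear)
  then have j: "\<eta> (lie (lie X Y) Z) u + \<eta> (lie (lie Y Z) X) u + \<eta> (lie (lie Z X) Y) u = 0"
    using assms by (simp add: closed linear)
  have lD: "G (lie X Y) (\<phi> Z) u = G (D X Y) (\<phi> Z) u - G (D Y X) (\<phi> Z) u"
    if "X \<in> L" "Y \<in> L" "Z \<in> L" for X Y Z
    using that by (simp add: torsion_free linear closed)
  have s: "G Y (\<phi> (D X Z)) u = - G (D X Z) (\<phi> Y) u" if "X \<in> L" "Y \<in> L" "Z \<in> L" for X Y Z
    using that phi_skew[of Y "D X Z"] by (simp add: closed G_sym)
  note der = derivative_fundamental_form
  have "X (G Y (\<phi> Z)) u + Y (G Z (\<phi> X)) u + Z (G X (\<phi> Y)) u =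
      G (lie X Y) (\<phi> Z) u + G (lie Y Z) (\<phi> X) u + G (lie Z X) (\<phi> Y) u"
    using assms j by (simp add: d l)
  then show ?thesis using assms by (simp add: lD der s)
qed

text \<open>
  Differentiate \<open>G(\<xi>, \<xi>) = 1\<close>.
\<close>

lemma D_xi_xi_orthogonal: assumes "X \<in> L" shows "\<eta> (D X \<xi>) = 0"
proof
  fix u
  have "G \<xi> \<xi> = (\<lambda>_. 1)" by (simp add: G_xi closed eta_xi fun_eq_iff)
  then have "G (D X \<xi>) \<xi> + G \<xi> (D X \<xi>) = 0"
    using G_parallel[OF assms xi_closed xi_closed] apply_const[OF assms, of 1] by simp
  then have "\<eta> (D X \<xi>) u + \<eta> (D X \<xi>) u = 0"
    using assms by (simp add: G_xi closed fun_eq_iff)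
  then show "\<eta> (D X \<xi>) u = 0 u" by simp
qed

lemma derivative_eta:
  assumes "X \<in> L" "Y \<in> L" shows "X (\<eta> Y) = G (D X \<xi>) Y + \<eta> (D X Y)"
  using assms G_parallel[of X \<xi> Y] by (simp add: G_xi closed)

lemma contact_D:
  assumes "X \<in> L" "Y \<in> L" shows "G X (\<phi> Y) = G (D X \<xi>) Y - G (D Y \<xi>) X"
  using assms by (simp add: contact_apply derivative_eta torsion_free linear closed fun_eq_iff)

lemma D_xi_xi: "D \<xi> \<xi> = 0"
proof (rule G_nondegenerate)
  fix Y assume "Y \<in> L"
  then show "G (D \<xi> \<xi>) Y = 0"
    using contact_D[of \<xi> Y] by (simp add: closed G_xi eta_phi D_xi_xi_orthogonal)
qed (simp add: closed)

lemma nijenhuis_nabla_phi: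
  assumes "X \<in> L" "Y \<in> L"
  shows "nijenhuis \<phi> X Y =
    nabla_phi (\<phi> X) Y - nabla_phi (\<phi> Y) X + \<phi> (nabla_phi Y X) - \<phi> (nabla_phi X Y)"
  using assms by (simp add: nijenhuis_def torsion_free linear closed nabla_phi_def)

lemma nabla_phi_xi: "X \<in> L \<Longrightarrow> nabla_phi X \<xi> = - \<phi> (D X \<xi>)"
  by (simp add: nabla_phi_def phi_xi linear)

lemma nabla_Phi_xi: assumes "X \<in> L" "Y \<in> L" shows "nabla_Phi X Y \<xi> u = - G Y (\<phi> (D X \<xi>)) u"
proof -
  show ?thesis using assms by (simp add: nabla_Phi_def nabla_phi_xi linear closed)
qed

text \<open>
  In terms of the Lie derivative along \<open>\<xi>\<close> the statement is \<open>L\<^sub>\<xi> \<phi> = 0\<close>.  Normality at the pair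
  \<open>\<xi>, Y\<close> shows that \<open>\<phi>\<close> annihilates the difference of the two sides, so that this difference is a
  multiple of \<open>\<xi>\<close>; its \<open>\<eta>\<close>-component vanishes.
\<close>

lemma nabla_xi_phi:
  assumes "Y \<in> L" shows "nabla_phi \<xi> Y = D (\<phi> Y) \<xi> - \<phi> (D Y \<xi>)"
proof -
  let ?W = "D (\<phi> Y) \<xi> - \<phi> (D Y \<xi>) - nabla_phi \<xi> Y"
  have W: "?W \<in> L" using assms by (simp add: closed nabla_phi_closed)
  have "nijenhuis \<phi> \<xi> Y = 0"
    using assms by (simp add: normal G_xi eta_phi closed linear)
  moreover have "nijenhuis \<phi> \<xi> Y = \<phi> (D (\<phi> Y) \<xi>) - \<phi> (\<phi> (D Y \<xi>)) - \<phi> (nabla_phi \<xi> Y)"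
  proof -
    have "nabla_phi 0 Y = 0" using assms by (simp add: nabla_phi_def linear closed)
    then show ?thesis
      using assms by (simp add: nijenhuis_nabla_phi nabla_phi_xi closed phi_xi linear)
  qed
  ultimately have "\<phi> ?W = 0" using assms by (simp add: linear closed nabla_phi_closed)
  then have "?W = \<eta> ?W \<cdot> \<xi>" using phi_phi[OF W] by (simp add: phi_zero)
  moreover have "\<eta> (nabla_phi \<xi> Y) = 0"
    using nabla_Phi_skew[of \<xi> \<xi> Y] nabla_Phi_xi[of \<xi> Y] assms
    by (simp add: fun_eq_iff nabla_Phi_def closed nabla_phi_closed G_xi D_xi_xi linear)
  then have "\<eta> ?W = 0"
    using assms by (simp add: linear closed nabla_phi_closed D_xi_xi_orthogonal eta_phi)
  ultimately have "?W = 0" by (simp add: linear)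
  then show ?thesis by simp
qed

text \<open>
  By \<open>L\<^sub>\<xi> \<phi> = 0\<close>, the cyclic identity at \<open>\<xi>, X, Y\<close> is the claim for \<open>\<phi> Y\<close> in place of \<open>Y\<close>.  Every
  field is \<open>\<phi> (\<phi> Y) + \<eta>(Y) \<xi>\<close>, and \<open>D\<^sub>\<xi> \<xi> = 0\<close> deals with the second summand.
\<close>

lemma xi_Killing:
  assumes "X \<in> L" "Y \<in> L" shows "G (D Y \<xi>) X u = - G (D X \<xi>) Y u"
proof -
  have phi: "G (D (\<phi> Y) \<xi>) X u = - G (D X \<xi>) (\<phi> Y) u" if "Y \<in> L" for Y
  proof -
    have "nabla_Phi \<xi> X Y u = G (D (\<phi> Y) \<xi>) X u - G X (\<phi> (D Y \<xi>)) u"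
      using that assms(1) by (simp add: nabla_Phi_def nabla_xi_phi linear closed G_sym[of X])
    moreover have "nabla_Phi X Y \<xi> u = - G Y (\<phi> (D X \<xi>)) u" using that assms(1) by (rule nabla_Phi_xi[rotated])
    moreover have "nabla_Phi Y \<xi> X u = G X (\<phi> (D Y \<xi>)) u"
      using that assms(1) nabla_Phi_skew[of Y \<xi> X] nabla_Phi_xi[of Y X] by (simp add: closed)
    moreover have "G Y (\<phi> (D X \<xi>)) u = - G (D X \<xi>) (\<phi> Y) u"
      using that assms(1) phi_skew[of Y "D X \<xi>"] by (simp add: closed G_sym)
    ultimately show ?thesis
      using nabla_Phi_cyclic[OF xi_closed assms(1) that, of u] by simp
  qed
  have Y: "Y = \<phi> (\<phi> Y) + \<eta> Y \<cdot> \<xi>" using phi_phi[OF assms(2)] by simp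
  have "D Y \<xi> = D (\<phi> (\<phi> Y)) \<xi>"
  proof -
    have "D (\<phi> (\<phi> Y) + \<eta> Y \<cdot> \<xi>) \<xi> = D (\<phi> (\<phi> Y)) \<xi> + \<eta> Y \<cdot> D \<xi> \<xi>"
      using assms(2) by (simp only: D_add_left D_smul_left closed)
    then show ?thesis using Y by (simp add: D_xi_xi linear)
  qed
  then show ?thesis
    using phi[of "\<phi> Y"] assms phi_phi[OF assms(2)]
    by (simp add: closed linear G_xi D_xi_xi_orthogonal)
qed

lemma G_D_xi: assumes "X \<in> L" "Y \<in> L" shows "G (D X \<xi>) Y u = - (1/2) * G (\<phi> X) Y u"
  using xi_Killing[OF assms, of u] fun_cong[OF contact_D[OF assms], of u]
    fun_cong[OF phi_skew[OF assms], of u] by simp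

lemma D_xi: assumes "X \<in> L" shows "D X \<xi> = (\<lambda>_. - (1/2)) \<cdot> \<phi> X"
proof -
  have "D X \<xi> - (\<lambda>_. - (1/2)) \<cdot> \<phi> X = 0"
    by (rule G_nondegenerate)
      (use assms in \<open>simp_all add: closed linear G_D_xi fun_eq_iff\<close>)
  then show ?thesis by simp
qed

text \<open>
  The covariant derivative of \<open>\<phi>\<^sup>2 = I - \<eta> \<otimes> \<xi>\<close>: up to the terms coming from \<open>\<eta> \<otimes> \<xi>\<close>, the derivative
  of \<open>\<phi>\<close> anticommutes with \<open>\<phi>\<close>.
\<close>

lemma nabla_Phi_phi:
  assumes "W \<in> L" "X \<in> L" "Y \<in> L"
  shows "nabla_Phi W X (\<phi> Y) u + nabla_Phi W Y (\<phi> X) u =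
    (1/2) * (\<eta> X u * G (\<phi> W) Y u + \<eta> Y u * G (\<phi> W) X u)"
proof -
  have "D W (\<phi> (\<phi> Y)) = D W Y - (W (\<eta> Y) \<cdot> \<xi> + \<eta> Y \<cdot> D W \<xi>)"
    using assms by (simp add: phi_phi linear closed)
  moreover have "\<phi> (D W (\<phi> Y)) = \<phi> (nabla_phi W Y) + (D W Y - \<eta> (D W Y) \<cdot> \<xi>)"
    using assms by (simp add: D_phi linear closed nabla_phi_closed phi_phi)
  ultimately have "nabla_phi W (\<phi> Y) = (D W Y - (W (\<eta> Y) \<cdot> \<xi> + \<eta> Y \<cdot> D W \<xi>)) -
      (\<phi> (nabla_phi W Y) + (D W Y - \<eta> (D W Y) \<cdot> \<xi>))"
    by (simp add: nabla_phi_def)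
  then have "nabla_Phi W X (\<phi> Y) u = G X (D W Y) u - (W (\<eta> Y) u * \<eta> X u + \<eta> Y u * G X (D W \<xi>) u) -
      (G X (\<phi> (nabla_phi W Y)) u + (G X (D W Y) u - \<eta> (D W Y) u * \<eta> X u))"
    using assms by (simp add: nabla_Phi_def linear closed nabla_phi_closed G_xi)
  moreover have "G X (\<phi> (nabla_phi W Y)) u = - nabla_Phi W (\<phi> X) Y u"
    using assms by (simp add: nabla_Phi_def phi_skew nabla_phi_closed)
  moreover have "nabla_Phi W (\<phi> X) Y u = - nabla_Phi W Y (\<phi> X) u"
    using assms by (intro nabla_Phi_skew) (simp_all add: closed)
  moreover have "W (\<eta> Y) u = - (1/2) * G (\<phi> W) Y u + \<eta> (D W Y) u"
    using assms by (simp add: derivative_eta G_D_xi)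
  moreover have "G X (D W \<xi>) u = - (1/2) * G (\<phi> W) X u"
    using assms by (simp add: G_sym[of X] G_D_xi closed)
  ultimately show ?thesis by (simp add: algebra_simps)
qed

text \<open>
  Normality, with the Nijenhuis tensor written through the covariant derivative of \<open>\<phi>\<close>.
\<close>

lemma nabla_Phi_normal:
  assumes "X \<in> L" "Y \<in> L" "Z \<in> L"
  shows "nabla_Phi (\<phi> X) Z Y u - nabla_Phi (\<phi> Y) Z X u - nabla_Phi Y (\<phi> Z) X u + nabla_Phi X (\<phi> Z) Y u
    = G X (\<phi> Y) u * \<eta> Z u"
proof -
  have "G Z (nijenhuis \<phi> X Y) u = G X (\<phi> Y) u * \<eta> Z u"
    using assms by (simp add: normal linear closed G_xi)
  moreover have "G Z (nijenhuis \<phi> X Y) u = nabla_Phi (\<phi> X) Z Y u - nabla_Phi (\<phi> Y) Z X u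
      + G Z (\<phi> (nabla_phi Y X)) u - G Z (\<phi> (nabla_phi X Y)) u"
    using assms by (simp add: nijenhuis_nabla_phi linear closed nabla_phi_closed nabla_Phi_def)
  moreover have "G Z (\<phi> (nabla_phi Y X)) u = - nabla_Phi Y (\<phi> Z) X u"
    "G Z (\<phi> (nabla_phi X Y)) u = - nabla_Phi X (\<phi> Z) Y u"
    using assms by (simp_all add: nabla_Phi_def phi_skew nabla_phi_closed)
  ultimately show ?thesis by simp
qed

text \<open>
  In the normality identity, the cyclic identity moves \<open>\<phi>\<close> out of the direction of
  differentiation in the first two terms.  The terms then pair up under \<open>nabla_Phi_phi\<close>: those
  differentiated in the directions \<open>X\<close> and \<open>Y\<close> reduce to products of \<open>\<eta>\<close> and \<open>\<Phi>\<close>, and those in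
  direction \<open>Z\<close> add up, again apart from such products, to twice the term on the left.
\<close>

lemma nabla_Phi_phi_right:
  assumes "X \<in> L" "Y \<in> L" "Z \<in> L"
  shows "2 * nabla_Phi Z X (\<phi> Y) u = \<eta> X u * G (\<phi> Z) Y u"
proof -
  have skew: "G (\<phi> U) W u = - G (\<phi> W) U u" if "U \<in> L" "W \<in> L" for U W
    using phi_skew[of U W] G_sym[of U "\<phi> W"] that by (simp add: closed)
  have "nabla_Phi (\<phi> X) Z Y u + nabla_Phi Z Y (\<phi> X) u + nabla_Phi Y (\<phi> X) Z u = 0"
    "nabla_Phi (\<phi> Y) Z X u + nabla_Phi Z X (\<phi> Y) u + nabla_Phi X (\<phi> Y) Z u = 0"
    using assms by (auto intro!: nabla_Phi_cyclic simp: closed)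
  moreover have "nabla_Phi Y (\<phi> X) Z u = - nabla_Phi Y Z (\<phi> X) u" "nabla_Phi X (\<phi> Y) Z u = - nabla_Phi X Z (\<phi> Y) u"
    "nabla_Phi Y (\<phi> Z) X u = - nabla_Phi Y X (\<phi> Z) u" "nabla_Phi X (\<phi> Z) Y u = - nabla_Phi X Y (\<phi> Z) u"
    using assms by (auto intro!: nabla_Phi_skew simp: closed)
  moreover have "G X (\<phi> Y) u = G (\<phi> Y) X u" using assms by (simp add: G_sym closed)
  moreover note nabla_Phi_normal[OF assms, of u] nabla_Phi_phi[OF assms(3,1,2), of u]
    nabla_Phi_phi[OF assms(2,1,3), of u] nabla_Phi_phi[OF assms(1,2,3), of u]
    skew[OF assms(1,2)] skew[OF assms(2,3)] skew[OF assms(1,3)]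
  ultimately show ?thesis by (simp add: algebra_simps)
qed

text \<open>
  The previous formula for \<open>\<phi> Y\<close> in place of \<open>Y\<close> covers the part \<open>\<phi> (\<phi> Y)\<close> of \<open>Y\<close>; the remaining part
  \<open>\<eta>(Y) \<xi>\<close> is known from \<open>D_xi\<close>.
\<close>

lemma nabla_Phi_formula:
  assumes "X \<in> L" "Y \<in> L" "Z \<in> L"
  shows "2 * nabla_Phi Z X Y u = \<eta> Y u * G X Z u - \<eta> X u * G Z Y u"
proof -
  have Y: "Y = \<phi> (\<phi> Y) + \<eta> Y \<cdot> \<xi>" using phi_phi[OF assms(2)] by simp
  have "nabla_phi Z (\<phi> (\<phi> Y) + \<eta> Y \<cdot> \<xi>) = nabla_phi Z (\<phi> (\<phi> Y)) + \<eta> Y \<cdot> nabla_phi Z \<xi>"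
    using assms by (simp add: nabla_phi_def linear closed phi_xi)
      (simp add: smul_def fun_eq_iff)
  then have "nabla_phi Z Y = nabla_phi Z (\<phi> (\<phi> Y)) + \<eta> Y \<cdot> nabla_phi Z \<xi>"
    using Y by simp
  then have "nabla_Phi Z X Y u = nabla_Phi Z X (\<phi> (\<phi> Y)) u + \<eta> Y u * nabla_Phi Z X \<xi> u"
    using assms by (simp add: nabla_Phi_def linear closed nabla_phi_closed)
  moreover have "nabla_Phi Z X \<xi> u = (1/2) * (G X Z u - \<eta> X u * \<eta> Z u)"
    using assms by (simp add: nabla_Phi_xi D_xi linear closed phi_phi G_xi)
  moreover have "2 * nabla_Phi Z X (\<phi> (\<phi> Y)) u = \<eta> X u * G (\<phi> Z) (\<phi> Y) u"
    using nabla_Phi_phi_right[of X "\<phi> Y" Z] assms by (simp add: closed)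
  moreover have "G (\<phi> Z) (\<phi> Y) u = - G Z Y u + \<eta> Z u * \<eta> Y u"
    using assms by (simp add: G_phi_phi)
  ultimately show ?thesis by (simp add: algebra_simps)
qed

lemma curvature_closed: "X \<in> L \<Longrightarrow> Y \<in> L \<Longrightarrow> Z \<in> L \<Longrightarrow> curvature D X Y Z \<in> L"
  by (simp add: curvature_def closed)

text \<open>
  As \<open>D\<^sub>Y \<xi> = - (1/2) \<phi> Y\<close> and \<open>D\<close> is torsion-free, the curvature applied to \<open>\<xi>\<close> is \<open>- 1/2\<close> times the
  alternating difference of the covariant derivative of \<open>\<phi>\<close>.
\<close>

lemma curvature_xi:
  assumes "X \<in> L" "Y \<in> L"
  shows "curvature D X Y \<xi> = (\<lambda>_. - (1/4)) \<cdot> (\<eta> Y \<cdot> X - \<eta> X \<cdot> Y)"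
proof -
  have "G (curvature D X Y \<xi>) Z u = - (1/4) * (\<eta> Y u * G X Z u - \<eta> X u * G Y Z u)"
    if "Z \<in> L" for Z u
  proof -
    let ?h = "\<lambda>_::'p. - (1/2) :: real"
    have "curvature D X Y \<xi> = ?h \<cdot> nabla_phi X Y - ?h \<cdot> nabla_phi Y X"
    proof -
      have "curvature D X Y \<xi> = ?h \<cdot> D X (\<phi> Y) - ?h \<cdot> D Y (\<phi> X) - ?h \<cdot> \<phi> (lie X Y)"
        using assms by (simp add: curvature_def D_xi D_smul_const closed)
      then show ?thesis
        using assms by (simp add: torsion_free linear closed nabla_phi_def smul_def fun_eq_iff diff_divide_distrib)
    qed
    then have "G (curvature D X Y \<xi>) Z u = - (1/2) * nabla_Phi X Z Y u + (1/2) * nabla_Phi Y Z X u"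
      using that assms by (simp add: linear closed nabla_phi_closed nabla_Phi_def G_sym[of Z])
    moreover have "2 * nabla_Phi X Z Y u = \<eta> Y u * G X Z u - \<eta> Z u * G X Y u"
      using nabla_Phi_formula[of Z Y X u] that assms by (simp add: G_sym[of Z])
    moreover have "2 * nabla_Phi Y Z X u = \<eta> X u * G Y Z u - \<eta> Z u * G X Y u"
      using nabla_Phi_formula[of Z X Y u] that assms by (simp add: G_sym[of Z] G_sym[of Y X])
    ultimately show ?thesis by argo
  qed
  then have "curvature D X Y \<xi> - (\<lambda>_. - (1/4)) \<cdot> (\<eta> Y \<cdot> X - \<eta> X \<cdot> Y) = 0"
    by (intro G_nondegenerate)
      (use assms in \<open>simp_all add: closed curvature_closed linear fun_eq_iff\<close>)
  then show ?thesis by simp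
qed

text \<open>
  In the derivative of \<open>curvature_xi\<close> along \<open>W\<close> all terms cancel in which \<open>X\<close> or \<open>Y\<close> is differentiated.
  What remains is \<open>R(X, Y) D\<^sub>W \<xi>\<close> on one side and the covariant derivative of \<open>\<eta>\<close>, again given by
  \<open>D\<^sub>W \<xi> = - (1/2) \<phi> W\<close>, on the other.
\<close>

lemma curvature_phi:
  assumes sym: "\<And>W X Y Z. W \<in> L \<Longrightarrow> X \<in> L \<Longrightarrow> Y \<in> L \<Longrightarrow> Z \<in> L \<Longrightarrow>
      D W (curvature D X Y Z) = curvature D (D W X) Y Z
        + curvature D X (D W Y) Z + curvature D X Y (D W Z)"
    and W: "W \<in> L" and X: "X \<in> L" and Y: "Y \<in> L" and Z: "Z \<in> L"
  shows "G (curvature D X Y (\<phi> W)) Z u =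
    - (1/4) * (G (\<phi> W) Y u * G X Z u - G (\<phi> W) X u * G Y Z u)"
proof -
  let ?h = "\<lambda>_::'p. - (1/2) :: real"
  let ?q = "\<lambda>_::'p. - (1/4) :: real"
  have "curvature D X Y (D W \<xi>) = ?h \<cdot> curvature D X Y (\<phi> W)"
    using W X Y by (simp add: curvature_def D_xi D_smul_const closed) (simp add: smul_def fun_eq_iff algebra_simps)
  then have "- (1/2) * G (curvature D X Y (\<phi> W)) Z u = G (curvature D X Y (D W \<xi>)) Z u"
    using W X Y Z by (simp add: linear closed curvature_closed)
  also have "\<dots> = G (D W (curvature D X Y \<xi>)) Z u - G (curvature D (D W X) Y \<xi>) Z u
      - G (curvature D X (D W Y) \<xi>) Z u"
    using W X Y Z by (simp add: sym linear closed curvature_closed)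
  also have "\<dots> = - (1/4) * ((W (\<eta> Y) u - \<eta> (D W Y) u) * G X Z u
      - (W (\<eta> X) u - \<eta> (D W X) u) * G Y Z u)"
    using W X Y Z by (simp add: curvature_xi linear closed apply_const algebra_simps)
  also have "\<dots> = - (1/4) * ((- (1/2) * G (\<phi> W) Y u) * G X Z u - (- (1/2) * G (\<phi> W) X u) * G Y Z u)"
    using W X Y by (simp add: derivative_eta G_D_xi)
  finally show ?thesis by (simp add: algebra_simps)
qed

lemma phi_section_curvature:
  assumes sym: "\<And>W X Y Z. W \<in> L \<Longrightarrow> X \<in> L \<Longrightarrow> Y \<in> L \<Longrightarrow> Z \<in> L \<Longrightarrow>
      D W (curvature D X Y Z) = curvature D (D W X) Y Z
        + curvature D X (D W Y) Z + curvature D X Y (D W Z)"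
    and X: "X \<in> L" and unit: "G X X u \<noteq> 0" and orth: "G X \<xi> u = 0"
  shows "flag_curvature G D X (\<phi> X) u = - (1/4)"
proof -
  have "G (\<phi> X) X u = 0" using phi_skew[OF X X] G_sym[of X "\<phi> X"] X by (simp add: closed fun_eq_iff)
  then have "G (curvature D X (\<phi> X) (\<phi> X)) X u = - (1/4) * (G (\<phi> X) (\<phi> X) u * G X X u)"
    using curvature_phi[OF sym X X _ X, of "\<phi> X" u] X by (simp add: closed)
  moreover have "G (\<phi> X) (\<phi> X) u = - G X X u"
    using G_phi_phi[OF X X] orth X by (simp add: G_xi)
  ultimately show ?thesis using unit by (simp add: flag_curvature_def)
qed

end


section \<open>Vertical vector fields\<close>

text \<open>
  The form in which the vertical bundle is an instance of \<open>hor_vfield\<close>.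
\<close>

lemma vertical_annihilator:
  "vertical AB AT \<pi> u =
     {x \<in> tangent_space AT u. \<forall>g\<in>(\<lambda>f. f \<circ> \<pi>) ` smooth_fun AB. x g = 0}"
  by (auto simp: vertical_def)

lemma vertical_subspace: "tv.subspace (vertical AB AT \<pi> u)"
proof -
  have "vertical AB AT \<pi> u = tangent_space AT u \<inter> {x. \<forall>f\<in>smooth_fun AB. x (f \<circ> \<pi>) = 0}"
    by (auto simp: vertical_def)
  moreover have "tv.subspace {x. \<forall>f\<in>smooth_fun AB. x (f \<circ> \<pi>) = 0}"
    by (auto simp: tv.subspace_def tscale_def)
  ultimately show ?thesis using tv.subspace_inter[OF tangent_space_subspace] by simp
qed

lemma vertical_lie:
  assumes A: "smooth_atlas AT"
    and X: "X \<in> sections AT (vertical AB AT \<pi>)" and Y: "Y \<in> sections AT (vertical AB AT \<pi>)"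
  shows "lie X Y \<in> sections AT (vertical AB AT \<pi>)"
proof -
  have vf: "X \<in> vfields AT" "Y \<in> vfields AT" using X Y by (auto simp: sections_def)
  have kill: "Z (f \<circ> \<pi>) = 0" if "Z \<in> sections AT (vertical AB AT \<pi>)" "f \<in> smooth_fun AB" for Z f
    using that by (auto simp: sections_def vertical_def val_apply fun_eq_iff)
  have "X 0 = 0" "Y 0 = 0"
    using vfield_apply_const[OF vf(1), of 0] vfield_apply_const[OF vf(2), of 0]
    by (simp_all add: zero_fun_def)
  then have "lie X Y (f \<circ> \<pi>) = 0" if "f \<in> smooth_fun AB" for f
    by (simp only: lie_apply kill[OF X that] kill[OF Y that]) simp
  then show ?thesis
    using vfields_lie[OF A vf] vfield_val[OF vfields_lie[OF A vf]]
    by (auto simp: sections_def vertical_def val_apply)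
qed

theorem proposition4p11:
  fixes AB :: "('b::{second_countable_topology, t2_space}, real^'n) chart set"
    and AT :: "('e::{second_countable_topology, t2_space}, (real^'n) \<times> (real^'m)) chart set"
    and \<pi> :: "'e \<Rightarrow> 'b"
    and vadd :: "'e \<Rightarrow> 'e \<Rightarrow> 'e"
    and vscale :: "real \<Rightarrow> 'e \<Rightarrow> 'e"
    and HE VE :: "'e dist"
    and \<phi> :: "'e vfield \<Rightarrow> 'e vfield"
    and \<eta> :: "'e vfield \<Rightarrow> 'e \<Rightarrow> real"
    and \<xi> :: "'e vfield"
    and G :: "'e vfield \<Rightarrow> 'e vfield \<Rightarrow> 'e \<Rightarrow> real"
    and D :: "'e vfield \<Rightarrow> 'e vfield \<Rightarrow> 'e vfield"
  assumes "smooth_vector_bundle AB AT \<pi> vadd vscale"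
    and "VE = vertical AB AT \<pi>"
    and "nonlinear_connection AB AT \<pi> HE"
    and "para_Sasakian_Finsler AT HE VE \<phi> \<eta> \<xi> G"
    and "Finsler_connection AT HE VE G D"
    and "locally_symmetric AT D"
  shows "has_vertical_phi_flag_curvature AT HE VE \<phi> \<xi> G D (- (1/4))"
proof -
  have atlas: "smooth_atlas AT" using assms(1) by (simp add: smooth_vector_bundle_def)
  have frame: "smooth_distribution TYPE('n) AT HE"
    using assms(3) by (simp add: nonlinear_connection_def)
  interpret HV: complementary_distributions AT HE VE
  proof
    show "HE u \<subseteq> tangent_space AT u" "tv.subspace (HE u)" for u
      using frame unfolding smooth_distribution_def by blast+
    show "VE u \<subseteq> tangent_space AT u" for u
      by (auto simp: assms(2) vertical_def)
    show "tv.subspace (VE u)" for u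
      by (simp add: assms(2) vertical_subspace)
    show "HE u \<inter> VE u = {0}" for u
      using assms(3) by (simp add: nonlinear_connection_def assms(2))
    show "\<exists>y\<in>HE u. \<exists>z\<in>VE u. x = y + z" if "x \<in> tangent_space AT u" for x u
      using assms(3) that by (simp add: nonlinear_connection_def assms(2))
  qed (rule atlas)
  interpret VH: complementary_distributions AT VE HE by (rule HV.swap)
  let ?L = "sections AT VE"
  let ?\<xi> = "ver HE VE \<xi>"

  have ann: "VE u = {x \<in> tangent_space AT u. \<forall>g\<in>(\<lambda>f. f \<circ> \<pi>) ` smooth_fun AB. x g = 0}" for u
    unfolding assms(2) by (rule vertical_annihilator)
  have vf: "X \<in> vfields AT" if "X \<in> ?L" for X using that by (simp add: sections_def)
  have ver_section: "ver HE VE X \<in> ?L" if "X \<in> vfields AT" for X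
  proof -
    let ?Y = "X - hor HE VE X"
    have val: "val ?Y u = val X u - val (hor HE VE X) u" for u
      by (simp add: fun_eq_iff val_apply)
    have "ver HE VE X = ?Y"
      unfolding ver_eq_hor
      by (rule VH.hor_eqI[OF that]) (use HV.val_hor[OF that] val in auto)
    moreover have "?Y \<in> vfields AT"
      using vfields_diff[OF atlas that HV.hor_vfield[OF frame ann that]] .
    ultimately show ?thesis using HV.val_hor(2)[OF that] val by (simp add: sections_def)
  qed
  have ver: "ver HE VE X = X" and hor: "hor HE VE X = 0" if "X \<in> ?L" for X
    using VH.hor_of_H[OF that] HV.hor_of_V[OF that] by (simp_all add: ver_eq_hor)
  have L_eqI: "X \<in> ?L" if "X \<in> vfields AT" "ver HE VE X = X" for X
    using ver_section[OF that(1)] that(2) by simp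
  have L_lie: "lie X Y \<in> ?L" if "X \<in> ?L" "Y \<in> ?L" for X Y
    using vertical_lie[OF atlas] that unfolding assms(2) by blast

  have pcm: "paracontact_metric_Finsler AT HE VE \<phi> \<eta> \<xi> G"
    and norm: "normal_structure AT HE VE \<phi> \<eta> \<xi>"
    using assms(4) by (simp_all add: para_Sasakian_Finsler_def)
  have apc: "almost_paracontact_Finsler AT HE VE \<phi> \<eta> \<xi>"
    and pm: "pseudo_metric_structure AT HE VE G"
    and G\<phi>: "\<And>X Y. X \<in> vfields AT \<Longrightarrow> Y \<in> vfields AT \<Longrightarrow> tensor_v HE VE G (\<phi> X) (\<phi> Y) =
          - tensor_v HE VE G X Y + form_v HE VE \<eta> X * form_v HE VE \<eta> Y"
    and d\<eta>: "\<And>X Y. X \<in> vfields AT \<Longrightarrow> Y \<in> vfields AT \<Longrightarrow>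
        ext_d (form_h HE VE \<eta>) X Y = fundamental_form \<phi> G (hor HE VE X) (hor HE VE Y) \<and>
        ext_d (form_v HE VE \<eta>) X Y = fundamental_form \<phi> G (ver HE VE X) (ver HE VE Y)"
    using pcm by (simp_all add: paracontact_metric_Finsler_def almost_paracontact_metric_Finsler_def)
  have \<phi>: "tensor11 AT \<phi>" and \<eta>: "one_form AT \<eta>" and \<xi>: "\<xi> \<in> vfields AT"
    and \<phi>V: "\<phi> ` ?L \<subseteq> ?L"
    and \<phi>\<phi>: "\<And>X. X \<in> vfields AT \<Longrightarrow> \<phi> (\<phi> X) =
        X - form_h HE VE \<eta> X \<cdot> hor HE VE \<xi> - form_v HE VE \<eta> X \<cdot> ver HE VE \<xi>"
    and \<eta>\<xi>: "form_v HE VE \<eta> ?\<xi> = 1"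
    using apc by (simp_all add: almost_paracontact_Finsler_def)
  have G: "\<And>X. X \<in> vfields AT \<Longrightarrow> one_form AT (G X)"
    and Gsym: "\<And>X Y. X \<in> vfields AT \<Longrightarrow> Y \<in> vfields AT \<Longrightarrow> G X Y = G Y X"
    and nondeg: "nondegenerate_on AT VE (tensor_v HE VE G)"
    using pm by (simp_all add: pseudo_metric_structure_def symmetric_tensor02_def)
  have D: "linear_connection AT D"
    and Dver: "\<And>X Y. X \<in> vfields AT \<Longrightarrow> Y \<in> vfields AT \<Longrightarrow> D X (ver HE VE Y) - ver HE VE (D X Y) = 0"
    and metr: "metrical AT G D" and sc: "symmetric_connection AT HE VE D"
    using assms(5) by (simp_all add: Finsler_connection_def d_connection_def)
  have z: "(0 :: 'e vfield) \<in> vfields AT"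
    using vfields_diff[OF atlas \<xi> \<xi>] by simp
  have form0: "\<omega> 0 = 0" if "one_form AT \<omega>" for \<omega>
  proof -
    have "\<omega> (0 + 0) = \<omega> 0 + \<omega> 0" using that z unfolding one_form_def by blast
    then show ?thesis by simp
  qed
  note \<eta>0 = form0[OF \<eta>]
  have G0: "G 0 X = 0" if "X \<in> vfields AT" for X
    using form0[OF G[OF that]] Gsym[OF z that] by simp
  have \<phi>0: "\<phi> 0 \<in> vfields AT" using \<phi> z by (simp add: tensor11_def)
  have lieL: "ver HE VE (lie X Y) = lie X Y" if "X \<in> ?L" "Y \<in> ?L" for X Y
    using ver L_lie that by blast
  \<comment> \<open>Only the vertical part of \<open>\<eta>\<close> contributes to the normality condition for vertical fields.\<close>
  have ext_h: "ext_d (form_h HE VE \<eta>) X Y = 0" if "X \<in> ?L" "Y \<in> ?L" for X Y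
    using d\<eta>[OF vf[OF that(1)] vf[OF that(2)]] G0[OF \<phi>0]
    by (simp add: fundamental_form_def hor that fun_eq_iff)
  have ext_v: "ext_d (form_v HE VE \<eta>) X Y = G X (\<phi> Y)" if "X \<in> ?L" "Y \<in> ?L" for X Y
    using d\<eta>[OF vf[OF that(1)] vf[OF that(2)]] by (simp add: fundamental_form_def ver that)
  have \<phi>L: "\<phi> X \<in> ?L" if "X \<in> ?L" for X using \<phi>V that by blast

  interpret PS: para_Sasakian_algebra AT ?L \<phi> \<eta> ?\<xi> G D
  proof
    show "X + Y \<in> ?L" if "X \<in> ?L" "Y \<in> ?L" for X Y
    proof -
      have "val (X + Y) u = val X u + val Y u" for u by (simp add: fun_eq_iff val_apply)
      then show ?thesis using that tv.subspace_add[OF HV.V_subspace] vfields_add[OF atlas]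
        by (simp add: sections_def)
    qed
    show "f \<cdot> X \<in> ?L" if "f \<in> smooth_fun AT" "X \<in> ?L" for f X
    proof -
      have "val (f \<cdot> X) u = tscale (f u) (val X u)" for u
        by (simp add: fun_eq_iff val_apply tscale_def smul_def)
      then show ?thesis using that tv.subspace_scale[OF HV.V_subspace] vfields_smul[OF atlas]
        by (simp add: sections_def)
    qed
    show "D X Y \<in> ?L" if "X \<in> ?L" "Y \<in> ?L" for X Y
      using Dver[OF vf vf] that D vf ver
      by (intro L_eqI) (simp_all add: linear_connection_def)
    show "lie X Y = D X Y - D Y X" if "X \<in> ?L" "Y \<in> ?L" for X Y
    proof -
      have "D (ver HE VE X) (ver HE VE Y) - D (ver HE VE Y) (ver HE VE X)
          - ver HE VE (lie (ver HE VE X) (ver HE VE Y)) = 0"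
        using sc vf that unfolding symmetric_connection_def by blast
      then show ?thesis by (simp add: ver lieL that)
    qed
    show "X (G Y Z) = G (D X Y) Z + G Y (D X Z)" if "X \<in> ?L" "Y \<in> ?L" "Z \<in> ?L" for X Y Z
    proof -
      have "X (G Y Z) - G (D X Y) Z - G Y (D X Z) = 0"
        using metr vf that by (simp add: metrical_def)
      then show ?thesis by (simp add: algebra_simps)
    qed
    show "G (X + Y) Z = G X Z + G Y Z" if "X \<in> ?L" "Y \<in> ?L" "Z \<in> ?L" for X Y Z
      using G[OF vf[OF that(3)]] vf[OF that(1)] vf[OF that(2)] vf[OF that(3)]
        vfields_add[OF atlas]
      by (simp add: one_form_def Gsym[of _ Z])
    show "G (f \<cdot> X) Y = f * G X Y" if "f \<in> smooth_fun AT" "X \<in> ?L" "Y \<in> ?L" for f X Y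
      using G[OF vf[OF that(3)]] that(1) vf[OF that(2)] vf[OF that(3)] vfields_smul[OF atlas]
      by (simp add: one_form_def Gsym[of _ Y])
    show "X = 0" if "X \<in> ?L" "\<And>Y. Y \<in> ?L \<Longrightarrow> G X Y = 0" for X
    proof (rule vfield_eqI)
      fix u
      have "tensor_v HE VE G X Y u = 0" if "Y \<in> ?L" for Y
        using that \<open>X \<in> ?L\<close> ver \<open>\<And>Y. Y \<in> ?L \<Longrightarrow> G X Y = 0\<close> by (simp add: tensor_v_def)
      then have "val X u = 0" using nondeg \<open>X \<in> ?L\<close> unfolding nondegenerate_on_def by blast
      then show "val X u = val 0 u" by (simp add: val_def fun_eq_iff)
    qed
    show "\<phi> (\<phi> X) = X - \<eta> X \<cdot> ?\<xi>" if "X \<in> ?L" for X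
      using \<phi>\<phi>[OF vf[OF that]] that
      by (simp add: form_h_def form_v_def hor ver \<eta>0 smul_zero_left)
    show "\<eta> ?\<xi> = 1" using \<eta>\<xi> ver[OF ver_section[OF \<xi>]] by (simp add: form_v_def)
    show "G (\<phi> X) (\<phi> Y) = - G X Y + \<eta> X * \<eta> Y" if "X \<in> ?L" "Y \<in> ?L" for X Y
      using G\<phi>[OF vf[OF that(1)] vf[OF that(2)]]
      by (simp add: tensor_v_def form_v_def ver \<phi>L that)
    show "ext_d \<eta> X Y = G X (\<phi> Y)" if "X \<in> ?L" "Y \<in> ?L" for X Y
      using ext_v[OF that] that by (simp add: ext_d_def form_v_def ver lieL)
    show "nijenhuis \<phi> X Y = G X (\<phi> Y) \<cdot> ?\<xi>" if "X \<in> ?L" "Y \<in> ?L" for X Y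
    proof -
      have "nijenhuis \<phi> X Y - ext_d (form_h HE VE \<eta>) X Y \<cdot> hor HE VE \<xi>
          - ext_d (form_v HE VE \<eta>) X Y \<cdot> ?\<xi> = 0"
        using norm vf that by (simp add: normal_structure_def)
      then show ?thesis using that by (simp add: ext_h ext_v smul_zero_left)
    qed
  qed (use atlas vf L_lie \<phi>L ver_section[OF \<xi>] D G Gsym \<phi> \<eta> in
      \<open>simp_all add: linear_connection_def one_form_def tensor11_def\<close>)

  have sym: "D W (curvature D X Y Z) = curvature D (D W X) Y Z
        + curvature D X (D W Y) Z + curvature D X Y (D W Z)"
    if "W \<in> ?L" "X \<in> ?L" "Y \<in> ?L" "Z \<in> ?L" for W X Y Z
  proof -
    have "D W (curvature D X Y Z) - curvature D (D W X) Y Z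
          - curvature D X (D W Y) Z - curvature D X Y (D W Z) = 0"
      using assms(6) vf that by (simp add: locally_symmetric_def)
    then show ?thesis by (simp add: algebra_simps)
  qed
  show ?thesis
    unfolding has_vertical_phi_flag_curvature_def spans_vertical_phi_section_def
    using PS.phi_section_curvature[OF sym] by force
qed

end
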